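(* Let $\mu\in\mathbb{R}$, let $M_\mu$ be the operator of convolution on $\ell^2(\mathcal{L})$ by $a+a^{-1}+b+b^{-1}-\mu c$, where $\mathcal{L}$ is the lamplighter group with elements $a,b,c$ as in the context, and let $\nu_\mu$ be the spectral measure of $M_\mu$ at $\delta_1$, i.e. $\nu_\mu(B)=\langle E_\mu(B)\delta_1,\delta_1\rangle$ for Borel $B\subseteq\mathbb{R}$. Then \[ \nu_{\mu}=\frac{1}{4}\delta_{\mu}+\sum_{k=2}^{\infty}\left[\frac{1}{2^{k+1}}\sum_{\{s:\,G_{k}(s,\mu)=0\}}\delta_s\right], \] where \[ G_{k}(z,\mu)=2^k\left[U_k\left(\frac{-z-\mu}{4}\right)+\mu\, U_{k-1}\left(\frac{-z-\mu}{4}\right)\right], \] $U_k$ is the degree $k$ Chebyshev polynomial of the second kind, $\delta_s$ denotes the unit point mass at $s$, and the zeros of $G_k(\cdot,\mu)$ in the sum are counted with multiplicities.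
   Context: The lamplighter group is $\mathcal{L}=\mathbb{Z}/2\mathbb{Z}\wr\mathbb{Z}=\left(\bigoplus_{\mathbb{Z}}\mathbb{Z}/2\mathbb{Z}\right)\rtimes\mathbb{Z}$, where a generator $a$ of $\mathbb{Z}$ acts on $\bigoplus_{\mathbb{Z}}\mathbb{Z}/2\mathbb{Z}$ by the automorphism induced by the shift of the index set $\mathbb{Z}$. The element $c$ (of order $2$) is $(\ldots,0,0,1,0,0,\ldots)\in\bigoplus_{\mathbb{Z}}\mathbb{Z}/2\mathbb{Z}$ with the entry $1$ at position $0$, and $b\in\mathcal{L}$ is determined by $c=b^{-1}a$ (so $b=ac$). The operator of convolution by an element of the group algebra is its image under the (left) regular representation on $\ell^2(\mathcal{L})$. For real $\mu$ the operator $M_\mu$ is bounded and self-adjoint; $E_\mu$ is its spectral projection-valued measure, $M_\mu=\int_{\mathbb{R}}\lambda\,dE_\mu(\lambda)$, and $\delta_1\in\ell^2(\mathcal{L})$ is the delta function at the identity $1\in\mathcal{L}$. The Chebyshev polynomials of the second kind are given by $U_0(x)=1$, $U_1(x)=2x$, $U_{n+1}(x)=2xU_n(x)-U_{n-1}(x)$. *)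

theory Defs
  imports
    "HOL-Algebra.Group"
    "HOL-Library.Poly_Mapping"
    "HOL-Library.Z2"
    "HOL-Computational_Algebra.Polynomial"
    "HOL-Probability.Giry_Monad"
begin

section \<open>The lamplighter group\<close>

text \<open>
  The type \<open>int \<Rightarrow>\<^sub>0 bit\<close> of finitely supported functions is the direct sum
  of copies of Z/2Z indexed by the integers.  The integer \<open>n\<close> moves the entry at
  position \<open>i\<close> to position \<open>i + n\<close>.
\<close>

definition shift :: "int \<Rightarrow> (int \<Rightarrow>\<^sub>0 bit) \<Rightarrow> (int \<Rightarrow>\<^sub>0 bit)" where
  "shift n f = Poly_Mapping.map_key (\<lambda>i. i - n) f"

lemma lookup_shift: "Poly_Mapping.lookup (shift n f) i = Poly_Mapping.lookup f (i - n)"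
  unfolding shift_def by (subst map_key.rep_eq) (auto simp: inj_on_def)

definition lamplighter :: "((int \<Rightarrow>\<^sub>0 bit) \<times> int) monoid" where
  "lamplighter =
     \<lparr>carrier = UNIV,
      monoid.mult = (\<lambda>(f, m) (g, n). (f + shift m g, m + n)),
      monoid.one = (0, 0)\<rparr>"

lemma group_lamplighter: "group lamplighter"
proof (rule groupI)
  fix x assume "x \<in> carrier lamplighter"
  obtain f n where x: "x = (f, n)" by fastforce
  have "(- shift (- n) f, - n) \<otimes>\<^bsub>lamplighter\<^esub> x = \<one>\<^bsub>lamplighter\<^esub>"
    by (simp add: x lamplighter_def)
  moreover have "(- shift (- n) f, - n) \<in> carrier lamplighter"
    by (simp add: lamplighter_def)
  ultimately show "\<exists>y\<in>carrier lamplighter. y \<otimes>\<^bsub>lamplighter\<^esub> x = \<one>\<^bsub>lamplighter\<^esub>"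
    by blast
qed (auto simp: lamplighter_def poly_mapping_eq_iff fun_eq_iff lookup_add lookup_shift
       algebra_simps split: prod.splits)

definition gen_a :: "(int \<Rightarrow>\<^sub>0 bit) \<times> int" where
  "gen_a = (0, 1)"

definition gen_c :: "(int \<Rightarrow>\<^sub>0 bit) \<times> int" where
  "gen_c = (Poly_Mapping.single 0 1, 0)"

definition gen_b :: "(int \<Rightarrow>\<^sub>0 bit) \<times> int" where
  "gen_b = gen_a \<otimes>\<^bsub>lamplighter\<^esub> gen_c"

lemma gen_c_squared: "gen_c \<otimes>\<^bsub>lamplighter\<^esub> gen_c = \<one>\<^bsub>lamplighter\<^esub>"
proof -
  have "shift 0 f = f" for f
    by (rule poly_mapping_eqI) (simp add: lookup_shift)
  moreover have "Poly_Mapping.single 0 (1 :: bit) + Poly_Mapping.single 0 1 = (0 :: int \<Rightarrow>\<^sub>0 bit)"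
    unfolding single_add [symmetric] by (metis add_bit_eq_xor bit.xor_self single_zero)
  ultimately show ?thesis
    by (simp only: lamplighter_def gen_c_def monoid.simps partial_object.simps split add_0)
qed

lemma gen_c_eq: "gen_c = inv\<^bsub>lamplighter\<^esub> gen_b \<otimes>\<^bsub>lamplighter\<^esub> gen_a"
proof -
  interpret group lamplighter by (rule group_lamplighter)
  have carr: "x \<in> carrier lamplighter" for x by (simp add: lamplighter_def)
  have "gen_b \<otimes>\<^bsub>lamplighter\<^esub> gen_c = gen_a"
    by (simp add: gen_b_def m_assoc carr gen_c_squared)
  then show ?thesis by (metis carr inv_solve_left)
qed


section \<open>Square-summable functions and convolution operators\<close>

definition ell2 :: "('a \<Rightarrow> complex) set" where
  "ell2 = {x. (\<lambda>g. (cmod (x g))\<^sup>2) summable_on UNIV}"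

definition ell2_inner :: "('a \<Rightarrow> complex) \<Rightarrow> ('a \<Rightarrow> complex) \<Rightarrow> complex" where
  "ell2_inner x y = (\<Sum>\<^sub>\<infinity>g. x g * cnj (y g))"

definition ell2_delta :: "'a \<Rightarrow> 'a \<Rightarrow> complex" where
  "ell2_delta g = (\<lambda>h. if h = g then 1 else 0)"

text \<open>
  In the next two definitions \<open>G\<close> is meant to be a group whose carrier is the whole
  type \<open>'a\<close>; its complex group algebra is then \<open>'a \<Rightarrow>\<^sub>0 complex\<close>.
\<close>

definition left_regular :: "'a monoid \<Rightarrow> 'a \<Rightarrow> ('a \<Rightarrow> complex) \<Rightarrow> ('a \<Rightarrow> complex)" where
  "left_regular G h x = (\<lambda>g. x (inv\<^bsub>G\<^esub> h \<otimes>\<^bsub>G\<^esub> g))"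

definition conv_operator ::
    "'a monoid \<Rightarrow> ('a \<Rightarrow>\<^sub>0 complex) \<Rightarrow> ('a \<Rightarrow> complex) \<Rightarrow> ('a \<Rightarrow> complex)" where
  "conv_operator G u x =
     (\<lambda>g. \<Sum>h\<in>Poly_Mapping.keys u. Poly_Mapping.lookup u h * left_regular G h x g)"

definition lamplighter_operator ::
    "real \<Rightarrow> ((int \<Rightarrow>\<^sub>0 bit) \<times> int \<Rightarrow> complex) \<Rightarrow> ((int \<Rightarrow>\<^sub>0 bit) \<times> int \<Rightarrow> complex)" where
  "lamplighter_operator \<mu> =
     conv_operator lamplighter
       (Poly_Mapping.single gen_a 1 + Poly_Mapping.single (inv\<^bsub>lamplighter\<^esub> gen_a) 1
        + Poly_Mapping.single gen_b 1 + Poly_Mapping.single (inv\<^bsub>lamplighter\<^esub> gen_b) 1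
        - Poly_Mapping.single gen_c (complex_of_real \<mu>))"


section \<open>Spectral resolutions\<close>

text \<open>
  Operators are functions on all of \<open>'a \<Rightarrow> complex\<close>, and only their values on
  \<^const>\<open>ell2\<close> matter.
\<close>

definition orthogonal_projection :: "(('a \<Rightarrow> complex) \<Rightarrow> ('a \<Rightarrow> complex)) \<Rightarrow> bool" where
  "orthogonal_projection P \<longleftrightarrow>
     (\<forall>x\<in>ell2. P x \<in> ell2) \<and>
     (\<forall>x\<in>ell2. \<forall>y\<in>ell2. P (\<lambda>g. x g + y g) = (\<lambda>g. P x g + P y g)) \<and>
     (\<forall>\<alpha>. \<forall>x\<in>ell2. P (\<lambda>g. \<alpha> * x g) = (\<lambda>g. \<alpha> * P x g)) \<and>
     (\<forall>x\<in>ell2. P (P x) = P x) \<and>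
     (\<forall>x\<in>ell2. \<forall>y\<in>ell2. ell2_inner (P x) y = ell2_inner x (P y))"

definition projection_valued_measure ::
    "(real set \<Rightarrow> ('a \<Rightarrow> complex) \<Rightarrow> ('a \<Rightarrow> complex)) \<Rightarrow> bool" where
  "projection_valued_measure E \<longleftrightarrow>
     (\<forall>B\<in>sets borel. orthogonal_projection (E B)) \<and>
     (\<forall>x\<in>ell2. E UNIV x = x) \<and>
     (\<forall>A\<in>sets borel. \<forall>B\<in>sets borel. \<forall>x\<in>ell2. E (A \<inter> B) x = E A (E B x)) \<and>
     (\<forall>B :: nat \<Rightarrow> real set. range B \<subseteq> sets borel \<longrightarrow> disjoint_family B \<longrightarrow>
        (\<forall>x\<in>ell2. \<forall>y\<in>ell2.
           (\<lambda>i. ell2_inner (E (B i) x) y) sums ell2_inner (E (\<Union>i. B i) x) y))"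

text \<open>
  The measure \<open>B \<mapsto> \<langle>E(B)x, x\<rangle>\<close>, whose values are non-negative reals because
  each \<open>E(B)\<close> is an orthogonal projection.
\<close>

definition spectral_measure_at ::
    "(real set \<Rightarrow> ('a \<Rightarrow> complex) \<Rightarrow> ('a \<Rightarrow> complex)) \<Rightarrow> ('a \<Rightarrow> complex) \<Rightarrow> real measure" where
  "spectral_measure_at E x =
     measure_of UNIV (sets borel) (\<lambda>B. ennreal (Re (ell2_inner (E B x) x)))"

text \<open>
  \<open>T = \<integral> t dE(t)\<close> for an everywhere defined operator \<open>T\<close>: the domain of the integral,
  i.e. the set of all \<open>x\<close> for which \<open>t\<^sup>2\<close> is integrable with respect to \<open>\<langle>E(\<cdot>)x, x\<rangle>\<close>,
  is the whole space, and \<open>\<langle>Tx, x\<rangle> = \<integral> t d\<langle>E(t)x, x\<rangle>\<close> for all \<open>x\<close>.  By polarization the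
  quadratic form determines \<open>T\<close>.
\<close>

definition spectral_resolution ::
    "(('a \<Rightarrow> complex) \<Rightarrow> ('a \<Rightarrow> complex)) \<Rightarrow>
     (real set \<Rightarrow> ('a \<Rightarrow> complex) \<Rightarrow> ('a \<Rightarrow> complex)) \<Rightarrow> bool" where
  "spectral_resolution T E \<longleftrightarrow>
     projection_valued_measure E \<and>
     (\<forall>x\<in>ell2.
        integrable (spectral_measure_at E x) (\<lambda>t. t\<^sup>2) \<and>
        ell2_inner (T x) x = complex_of_real (\<integral>t. t \<partial>spectral_measure_at E x))"


section \<open>The polynomials\<close>

fun chebyshev_U :: "nat \<Rightarrow> real poly" where
  "chebyshev_U 0 = 1"
| "chebyshev_U (Suc 0) = [:0, 2:]"
| "chebyshev_U (Suc (Suc n)) = [:0, 2:] * chebyshev_U (Suc n) - chebyshev_U n"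

text \<open>As a polynomial in \<open>z\<close>; the linear polynomial is \<open>(-z - \<mu>) / 4\<close>.  Used for \<open>k \<ge> 1\<close> only.\<close>

definition G_poly :: "nat \<Rightarrow> real \<Rightarrow> real poly" where
  "G_poly k \<mu> =
     smult (2 ^ k)
       (pcompose (chebyshev_U k) [:- \<mu> / 4, - 1 / 4:]
        + smult \<mu> (pcompose (chebyshev_U (k - 1)) [:- \<mu> / 4, - 1 / 4:]))"

end

theory Submission
  imports Defs "HOL-Computational_Algebra.Fundamental_Theorem_Algebra" "HOL-Real_Asymp.Real_Asymp"
begin

text \<open>
  Put \<open>p = (1 + c) / 2\<close>, so that the element defining the operator is \<open>2 a p + 2 p a\<^sup>-\<^sup>1 - \<mu> (2 p - 1)\<close>.
  The conjugates \<open>a\<^sup>j p a\<^sup>-\<^sup>j\<close> are commuting projections, and on their joint eigenspaces \<open>a\<close> acts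
  as a step along a path, an edge being open if the corresponding projection is 1 and closed if it is 0.
  A maximal open path with \<open>k\<close> vertices has weight \<open>2\<^sup>-\<^sup>k\<^sup>-\<^sup>1\<close> for each position of the origin in it,
  and there the operator is a \<open>k \<times> k\<close> Jacobi matrix whose eigenvalues are the zeros of \<open>G\<^sub>k\<close> and
  whose eigenvectors have Chebyshev polynomials as entries.  Summing over the positions gives the trace
  of a spectral projection, i.e. the number of eigenvalues in \<open>B\<close>.

  An eigenvector for \<open>s\<close> lies in the range of \<open>E {s}\<close>, so Bessel's inequality for these finitely
  supported eigenvectors bounds the spectral measure from below; as the bounds have total mass 1, they are sharp.
\<close>

section \<open>Square-summable functions and spectral resolutions\<close>

lemma ell2_inner_summable:
  assumes "x \<in> ell2" "y \<in> ell2"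
  shows "(\<lambda>g. x g * cnj (y g)) summable_on UNIV"
proof -
  have "(\<lambda>g. norm (x g * cnj (y g))) summable_on UNIV"
    using assms by (intro abs_summable_product[of x UNIV "\<lambda>g. cnj (y g)"])
      (simp_all add: ell2_def power2_eq_square norm_mult)
  then show ?thesis by (rule abs_summable_summable)
qed

lemma ell2_scale: "x \<in> ell2 \<Longrightarrow> (\<lambda>g. \<alpha> * x g) \<in> ell2"
  by (auto simp: ell2_def norm_mult power_mult_distrib intro!: summable_on_cmult_right)

lemma ell2_add:
  assumes "x \<in> ell2" "y \<in> ell2"
  shows "(\<lambda>g. x g + y g) \<in> ell2"
proof -
  have "(\<lambda>g. 2 * (cmod (x g))\<^sup>2 + 2 * (cmod (y g))\<^sup>2) summable_on UNIV"
    using assms by (intro summable_on_add summable_on_cmult_right) (auto simp: ell2_def)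
  moreover have "(cmod (x g + y g))\<^sup>2 \<le> 2 * (cmod (x g))\<^sup>2 + 2 * (cmod (y g))\<^sup>2" for g
  proof -
    have "(cmod (x g + y g))\<^sup>2 \<le> (cmod (x g) + cmod (y g))\<^sup>2"
      by (simp add: norm_triangle_ineq power_mono)
    also have "\<dots> \<le> 2 * (cmod (x g))\<^sup>2 + 2 * (cmod (y g))\<^sup>2"
      using zero_le_power2[of "cmod (x g) - cmod (y g)"] by (simp add: power2_eq_square algebra_simps)
    finally show ?thesis .
  qed
  ultimately show ?thesis
    unfolding ell2_def by (auto intro: summable_on_comparison_test)
qed

lemma ell2_diff: "x \<in> ell2 \<Longrightarrow> y \<in> ell2 \<Longrightarrow> (\<lambda>g. x g - y g) \<in> ell2"
  using ell2_add[of x "\<lambda>g. - 1 * y g"] ell2_scale[of y "- 1"] by simp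

lemma ell2_zero: "(\<lambda>_. 0) \<in> ell2"
  by (simp add: ell2_def)

lemma ell2_sum: "(\<And>i. i \<in> I \<Longrightarrow> x i \<in> ell2) \<Longrightarrow> (\<lambda>g. \<Sum>i\<in>I. x i g) \<in> ell2"
  by (induction I rule: infinite_finite_induct) (auto intro: ell2_add ell2_zero)

lemma ell2_finite_support: "finite {g. x g \<noteq> 0} \<Longrightarrow> x \<in> ell2"
  unfolding ell2_def mem_Collect_eq
  by (subst summable_on_cong_neutral[where T = "{g. x g \<noteq> 0}"]) auto

lemma ell2_delta_ell2: "ell2_delta g \<in> ell2"
  by (rule ell2_finite_support) (auto simp: ell2_delta_def intro: finite_subset[of _ "{g}"])

lemma ell2_inner_add_left:
  "x \<in> ell2 \<Longrightarrow> y \<in> ell2 \<Longrightarrow> z \<in> ell2 \<Longrightarrow>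
    ell2_inner (\<lambda>g. x g + y g) z = ell2_inner x z + ell2_inner y z"
  unfolding ell2_inner_def by (simp add: distrib_right infsum_add ell2_inner_summable)

lemma ell2_inner_scale_left: "ell2_inner (\<lambda>g. \<alpha> * x g) y = \<alpha> * ell2_inner x y"
  unfolding ell2_inner_def by (simp add: mult.assoc infsum_cmult_right')

lemma ell2_inner_commute: "ell2_inner x y = cnj (ell2_inner y x)"
  unfolding ell2_inner_def infsum_cnj[symmetric] by (simp add: mult.commute)

lemma ell2_inner_add_right:
  "x \<in> ell2 \<Longrightarrow> y \<in> ell2 \<Longrightarrow> z \<in> ell2 \<Longrightarrow>
    ell2_inner x (\<lambda>g. y g + z g) = ell2_inner x y + ell2_inner x z"
  using arg_cong[OF ell2_inner_add_left[of y z x], of cnj] by (simp flip: ell2_inner_commute)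

lemma ell2_inner_scale_right: "ell2_inner x (\<lambda>g. \<alpha> * y g) = cnj \<alpha> * ell2_inner x y"
  using arg_cong[OF ell2_inner_scale_left[of \<alpha> y x], of cnj] by (simp flip: ell2_inner_commute)

lemma ell2_inner_diff_left:
  "x \<in> ell2 \<Longrightarrow> y \<in> ell2 \<Longrightarrow> z \<in> ell2 \<Longrightarrow>
    ell2_inner (\<lambda>g. x g - y g) z = ell2_inner x z - ell2_inner y z"
  using ell2_inner_add_left[of x "\<lambda>g. - 1 * y g" z] ell2_scale[of y "- 1"]
    ell2_inner_scale_left[of "- 1" y z] by simp

lemma ell2_inner_diff_right:
  "x \<in> ell2 \<Longrightarrow> y \<in> ell2 \<Longrightarrow> z \<in> ell2 \<Longrightarrow>
    ell2_inner x (\<lambda>g. y g - z g) = ell2_inner x y - ell2_inner x z"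
  using arg_cong[OF ell2_inner_diff_left[of y z x], of cnj] by (simp flip: ell2_inner_commute)

lemma ell2_inner_zero [simp]: "ell2_inner (\<lambda>_. 0) y = 0" "ell2_inner x (\<lambda>_. 0) = 0"
  by (simp_all add: ell2_inner_def)

lemma ell2_inner_sum_left:
  "(\<And>i. i \<in> I \<Longrightarrow> x i \<in> ell2) \<Longrightarrow> y \<in> ell2 \<Longrightarrow>
    ell2_inner (\<lambda>g. \<Sum>i\<in>I. x i g) y = (\<Sum>i\<in>I. ell2_inner (x i) y)"
  by (induction I rule: infinite_finite_induct) (auto simp: ell2_inner_add_left ell2_sum)

lemma infsum_of_real_complex: "(\<Sum>\<^sub>\<infinity>g\<in>A. complex_of_real (f g)) = of_real (infsum f A)"
proof (cases "f summable_on A")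
  case True
  then show ?thesis
    by (intro infsumI has_sum_of_real) auto
next
  \<comment> \<open>Taking real parts shows that the complex family is not summable either, so both
    sums have the default value 0.\<close>
  case False
  then have "\<not> (\<lambda>g. complex_of_real (f g)) summable_on A"
    using summable_on_Re[of "\<lambda>g. complex_of_real (f g)" A] by auto
  then show ?thesis using False by (simp add: infsum_not_exists)
qed

lemma ell2_inner_self: "ell2_inner x x = of_real (\<Sum>\<^sub>\<infinity>g. (cmod (x g))\<^sup>2)"
proof -
  have "ell2_inner x x = (\<Sum>\<^sub>\<infinity>g. of_real ((cmod (x g))\<^sup>2))"
    unfolding ell2_inner_def by (intro infsum_cong) (simp add: complex_norm_square del: of_real_power)
  then show ?thesis
    by (simp only: infsum_of_real_complex)
qed

lemma ell2_inner_self_nonneg: "Re (ell2_inner x x) \<ge> 0"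
  by (simp add: ell2_inner_self infsum_nonneg)

lemma ell2_inner_self_real: "ell2_inner x x = of_real (Re (ell2_inner x x))"
  by (simp add: ell2_inner_self)

lemma ell2_inner_self_eq_0:
  assumes "x \<in> ell2" "Re (ell2_inner x x) = 0"
  shows "x = (\<lambda>_. 0)"
proof
  fix g
  have "(cmod (x g))\<^sup>2 = 0"
    using assms by (intro nonneg_infsum_le_0D[of "\<lambda>g. (cmod (x g))\<^sup>2" UNIV])
      (auto simp: ell2_inner_self ell2_def)
  then show "x g = 0" by simp
qed

text \<open>The vectors \<open>w i\<close> are orthogonal but not normalised, hence the
  denominators. The vector \<open>y\<close> is the projection of \<open>x\<close> onto their span,
  and the squared norm of \<open>x - y\<close> is the difference of the two sides.\<close>

lemma ell2_bessel:
  assumes "finite I" "x \<in> ell2" "\<And>i. i \<in> I \<Longrightarrow> w i \<in> ell2"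
    and "\<And>i j. i \<in> I \<Longrightarrow> j \<in> I \<Longrightarrow> i \<noteq> j \<Longrightarrow> ell2_inner (w i) (w j) = 0"
    and pos: "\<And>i. i \<in> I \<Longrightarrow> Re (ell2_inner (w i) (w i)) > 0"
  shows "(\<Sum>i\<in>I. (cmod (ell2_inner x (w i)))\<^sup>2 / Re (ell2_inner (w i) (w i))) \<le> Re (ell2_inner x x)"
proof -
  define N where "N i = Re (ell2_inner (w i) (w i))" for i
  define c where "c i = ell2_inner x (w i) / of_real (N i)" for i
  define y where "y g = (\<Sum>i\<in>I. c i * w i g)" for g
  define S where "S = (\<Sum>i\<in>I. (cmod (ell2_inner x (w i)))\<^sup>2 / N i)"
  have y: "y \<in> ell2"
    unfolding y_def using assms by (intro ell2_sum ell2_scale) auto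
  have yz: "ell2_inner y z = (\<Sum>i\<in>I. c i * ell2_inner (w i) z)" if "z \<in> ell2" for z
    unfolding y_def using assms that by (subst ell2_inner_sum_left) (auto simp: ell2_scale ell2_inner_scale_left)
  have yx: "ell2_inner y x = of_real S"
    unfolding yz[OF assms(2)] S_def of_real_sum
    by (intro sum.cong refl, subst ell2_inner_commute)
      (simp add: c_def complex_norm_square mult.commute del: of_real_power)
  have yw: "ell2_inner y (w j) = ell2_inner x (w j)" if "j \<in> I" for j
  proof -
    have "ell2_inner y (w j) = (\<Sum>i\<in>I. if i = j then c j * ell2_inner (w j) (w j) else 0)"
      unfolding yz[OF assms(3)[OF that]] using assms(4) that by (intro sum.cong) auto
    also have "\<dots> = c j * ell2_inner (w j) (w j)"
      using assms that by simp
    also have "\<dots> = ell2_inner x (w j)"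
    proof -
      have "ell2_inner (w j) (w j) = of_real (N j)"
        unfolding N_def by (rule ell2_inner_self_real)
      moreover have "N j \<noteq> 0" using pos[OF that] by (simp add: N_def)
      ultimately show ?thesis by (simp add: c_def)
    qed
    finally show ?thesis .
  qed
  have wy: "ell2_inner (w j) y = ell2_inner (w j) x" if "j \<in> I" for j
    using arg_cong[OF yw[OF that], of cnj] by (simp flip: ell2_inner_commute)
  have "ell2_inner y y = (\<Sum>i\<in>I. c i * ell2_inner (w i) y)"
    by (rule yz[OF y])
  also have "\<dots> = ell2_inner y x"
    unfolding yz[OF assms(2)] by (intro sum.cong) (simp_all add: wy)
  finally have yy: "ell2_inner y y = of_real S" using yx by simp
  have "ell2_inner (\<lambda>g. x g - y g) (\<lambda>g. x g - y g) = ell2_inner x x - of_real S"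
    using assms(2) y yx yy ell2_inner_commute[of x y]
    by (simp add: ell2_inner_diff_left ell2_inner_diff_right ell2_diff)
  then have "Re (ell2_inner x x) - S \<ge> 0"
    using ell2_inner_self_nonneg[of "\<lambda>g. x g - y g"] by simp
  then show ?thesis by (simp add: S_def N_def)
qed

section \<open>Projection-valued measures and the scalar measures they induce\<close>

context
  fixes E :: "real set \<Rightarrow> ('a \<Rightarrow> complex) \<Rightarrow> ('a \<Rightarrow> complex)"
  assumes pvm: "projection_valued_measure E"
begin

lemma
  assumes "B \<in> sets borel" "x \<in> ell2"
  shows pvm_ell2: "E B x \<in> ell2"
    and pvm_add: "y \<in> ell2 \<Longrightarrow> E B (\<lambda>g. x g + y g) = (\<lambda>g. E B x g + E B y g)"
    and pvm_scale: "E B (\<lambda>g. \<alpha> * x g) = (\<lambda>g. \<alpha> * E B x g)"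
    and pvm_selfadjoint: "y \<in> ell2 \<Longrightarrow> ell2_inner (E B x) y = ell2_inner x (E B y)"
    and pvm_UNIV: "E UNIV x = x"
    and pvm_Int: "A \<in> sets borel \<Longrightarrow> E A (E B x) = E (A \<inter> B) x"
    and pvm_inner: "ell2_inner (E B x) (E B x) = ell2_inner (E B x) x"
proof -
  have op: "orthogonal_projection (E B)"
    using pvm assms unfolding projection_valued_measure_def by blast
  show ell: "E B x \<in> ell2"
    using op assms unfolding orthogonal_projection_def by blast
  show "E B (\<lambda>g. \<alpha> * x g) = (\<lambda>g. \<alpha> * E B x g)"
    using op assms unfolding orthogonal_projection_def by blast
  show "E B (\<lambda>g. x g + y g) = (\<lambda>g. E B x g + E B y g)" if "y \<in> ell2"
    using op assms that unfolding orthogonal_projection_def by blast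
  show sa: "ell2_inner (E B x) y = ell2_inner x (E B y)" if "y \<in> ell2" for y
    using op assms that unfolding orthogonal_projection_def by blast
  show "E UNIV x = x"
    using pvm assms unfolding projection_valued_measure_def by blast
  show "E A (E B x) = E (A \<inter> B) x" if "A \<in> sets borel"
  proof -
    have "\<forall>A\<in>sets borel. \<forall>B\<in>sets borel. \<forall>x\<in>ell2. E (A \<inter> B) x = E A (E B x)"
      using pvm unfolding projection_valued_measure_def by blast
    then show ?thesis using assms that by simp
  qed
  have "E B (E B x) = E B x"
    using op assms unfolding orthogonal_projection_def by blast
  then show "ell2_inner (E B x) (E B x) = ell2_inner (E B x) x"
    using sa[OF ell] sa[OF assms(2)] by simp
qed

lemma pvm_sums:
  "range B \<subseteq> sets borel \<Longrightarrow> disjoint_family B \<Longrightarrow> x \<in> ell2 \<Longrightarrow> y \<in> ell2 \<Longrightarrow>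
    (\<lambda>i::nat. ell2_inner (E (B i) x) y) sums ell2_inner (E (\<Union>i. B i) x) y"
proof -
  have "\<forall>B :: nat \<Rightarrow> real set. range B \<subseteq> sets borel \<longrightarrow> disjoint_family B \<longrightarrow>
        (\<forall>x\<in>ell2. \<forall>y\<in>ell2. (\<lambda>i. ell2_inner (E (B i) x) y) sums ell2_inner (E (\<Union>i. B i) x) y)"
    using pvm unfolding projection_valued_measure_def by (elim conjE)
  then show "range B \<subseteq> sets borel \<Longrightarrow> disjoint_family B \<Longrightarrow> x \<in> ell2 \<Longrightarrow> y \<in> ell2 \<Longrightarrow>
    (\<lambda>i::nat. ell2_inner (E (B i) x) y) sums ell2_inner (E (\<Union>i. B i) x) y"
    by simp
qed

lemma pvm_nonneg:
  assumes "B \<in> sets borel" "x \<in> ell2"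
  shows "Re (ell2_inner (E B x) x) \<ge> 0"
  using pvm_inner[OF assms] ell2_inner_self_nonneg[of "E B x"] by simp

text \<open>Countable additivity for the constant sequence of empty sets gives a convergent series
  with constant terms, which forces the term to be 0.\<close>

lemma pvm_empty:
  assumes "x \<in> ell2"
  shows "E {} x = (\<lambda>_. 0)"
proof -
  have "(\<lambda>i::nat. ell2_inner (E {} x) x) sums ell2_inner (E {} x) x"
    using pvm_sums[of "\<lambda>_. {}" x x] assms by (simp add: disjoint_family_on_def)
  then have "ell2_inner (E {} x) x = 0"
    by (metis sums_summable summable_const_iff)
  then show ?thesis
    using pvm_inner[of "{}" x] pvm_ell2[of "{}" x] assms by (intro ell2_inner_self_eq_0) auto
qed

text \<open>Additivity is available only for inner products, so the defect \<open>u\<close> of the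
  claimed identity is tested against itself, which gives \<open>ell2_inner u u = 0\<close>.
  \<open>binaryset\<close> extends the pair of sets by empty sets.\<close>

lemma pvm_compl:
  assumes "A \<in> sets borel" "x \<in> ell2"
  shows "E (- A) x = (\<lambda>g. x g - E A x g)"
proof -
  define u where "u g = E A x g + E (- A) x g - x g" for g
  have *: "E A x \<in> ell2" "E (- A) x \<in> ell2" using assms by (auto intro: pvm_ell2)
  have u: "u \<in> ell2" unfolding u_def using * assms by (intro ell2_diff ell2_add)
  have uE: "u = (\<lambda>g. E A x g + E (- A) x g - x g)" by (simp add: u_def fun_eq_iff)
  have "(\<lambda>i. ell2_inner (E (binaryset A (- A) i) x) u) sums ell2_inner (E (\<Union>i. binaryset A (- A) i) x) u"
    using assms u by (intro pvm_sums) (auto simp: range_binaryset_eq disjoint_family_on_def binaryset_def)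
  moreover have "(\<lambda>i. ell2_inner (E (binaryset A (- A) i) x) u) sums
      (ell2_inner (E A x) u + ell2_inner (E (- A) x) u)"
    using assms by (intro binaryset_sums) (simp add: pvm_empty)
  ultimately have "ell2_inner (E A x) u + ell2_inner (E (- A) x) u = ell2_inner x u"
    unfolding UN_binaryset_eq using assms by (auto dest: sums_unique2 simp: pvm_UNIV)
  moreover have "ell2_inner u u = ell2_inner (E A x) u + ell2_inner (E (- A) x) u - ell2_inner x u"
    using * assms u
    by (subst (1) uE) (simp add: ell2_inner_diff_left ell2_inner_add_left ell2_add)
  ultimately have "ell2_inner u u = 0" by simp
  then have "u = (\<lambda>_. 0)" by (intro ell2_inner_self_eq_0 u) simp
  then have "u g = 0" for g by simp
  then show ?thesis
    unfolding u_def by (auto simp: fun_eq_iff algebra_simps)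
qed

lemma
  shows sets_spectral_measure_at [simp, measurable_cong]: "sets (spectral_measure_at E x) = sets borel"
    and space_spectral_measure_at [simp]: "space (spectral_measure_at E x) = UNIV"
  unfolding spectral_measure_at_def
  using sets.sigma_sets_eq[of "borel :: real measure"] by (auto simp: sets_measure_of_conv space_measure_of_conv)

lemma emeasure_spectral_measure_at:
  assumes "x \<in> ell2" "B \<in> sets borel"
  shows "emeasure (spectral_measure_at E x) B = ennreal (Re (ell2_inner (E B x) x))"
proof (rule emeasure_measure_of[OF spectral_measure_at_def])
  show "positive (sets (spectral_measure_at E x)) (\<lambda>B. ennreal (Re (ell2_inner (E B x) x)))"
    using assms by (simp add: positive_def pvm_empty)
  show "countably_additive (sets (spectral_measure_at E x)) (\<lambda>B. ennreal (Re (ell2_inner (E B x) x)))"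
    unfolding countably_additive_def sets_spectral_measure_at
  proof (intro allI impI)
    fix B :: "nat \<Rightarrow> real set"
    assume B: "range B \<subseteq> sets borel" "disjoint_family B" "\<Union> (range B) \<in> sets borel"
    have "(\<lambda>i. Re (ell2_inner (E (B i) x) x)) sums Re (ell2_inner (E (\<Union> (range B)) x) x)"
      using pvm_sums[OF B(1,2) assms(1) assms(1)] by (rule sums_Re)
    then have "(\<lambda>i. ennreal (Re (ell2_inner (E (B i) x) x))) sums ennreal (Re (ell2_inner (E (\<Union> (range B)) x) x))"
      using B assms pvm_nonneg by (subst sums_ennreal) auto
    then show "suminf (\<lambda>i. ennreal (Re (ell2_inner (E (B i) x) x))) = ennreal (Re (ell2_inner (E (\<Union> (range B)) x) x))"
      by (rule sums_unique[symmetric])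
  qed
qed (use assms in auto)

lemma finite_measure_spectral_measure_at:
  "x \<in> ell2 \<Longrightarrow> finite_measure (spectral_measure_at E x)"
  by (rule finite_measureI) (simp add: emeasure_spectral_measure_at)

text \<open>Self-adjointness and multiplicativity collapse the three projections to
  \<open>E (A \<inter> B)\<close>. This turns the quadratic form at \<open>E A x\<close> into an
  integral over \<open>A\<close>.\<close>

lemma spectral_measure_at_pvm:
  assumes "x \<in> ell2" "A \<in> sets borel"
  shows "spectral_measure_at E (E A x) = density (spectral_measure_at E x) (\<lambda>t. ennreal (indicator A t))"
proof (rule measure_eqI)
  fix B assume "B \<in> sets (spectral_measure_at E (E A x))"
  then have B: "B \<in> sets borel" by simp
  have "emeasure (spectral_measure_at E (E A x)) B = ennreal (Re (ell2_inner (E B (E A x)) (E A x)))"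
    using assms B by (simp add: emeasure_spectral_measure_at pvm_ell2)
  also have "ell2_inner (E B (E A x)) (E A x) = ell2_inner (E (A \<inter> B) x) x"
  proof -
    have "ell2_inner (E B (E A x)) (E A x) = ell2_inner (E A (E B (E A x))) x"
      using assms B by (intro pvm_selfadjoint[symmetric] pvm_ell2)
    then show ?thesis using assms B by (simp add: pvm_Int Int_ac)
  qed
  also have "ennreal (Re (ell2_inner (E (A \<inter> B) x) x)) = emeasure (spectral_measure_at E x) (A \<inter> B)"
    using assms B by (simp add: emeasure_spectral_measure_at)
  also have "\<dots> = (\<integral>\<^sup>+t. indicator (A \<inter> B) t \<partial>spectral_measure_at E x)"
    using assms B by (subst nn_integral_indicator) auto
  also have "\<dots> = (\<integral>\<^sup>+t. ennreal (indicator A t) * indicator B t \<partial>spectral_measure_at E x)"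
    by (intro nn_integral_cong) (auto simp: indicator_def)
  also have "\<dots> = emeasure (density (spectral_measure_at E x) (\<lambda>t. ennreal (indicator A t))) B"
    using assms B by (subst emeasure_density) auto
  finally show "emeasure (spectral_measure_at E (E A x)) B =
      emeasure (density (spectral_measure_at E x) (\<lambda>t. ennreal (indicator A t))) B" .
qed simp

end

section \<open>Eigenvectors under a spectral resolution\<close>

context
  fixes T :: "('a \<Rightarrow> complex) \<Rightarrow> ('a \<Rightarrow> complex)"
    and E :: "real set \<Rightarrow> ('a \<Rightarrow> complex) \<Rightarrow> ('a \<Rightarrow> complex)"
  assumes res: "spectral_resolution T E"
    and T_ell2: "\<And>x. x \<in> ell2 \<Longrightarrow> T x \<in> ell2"
    and T_linear: "\<And>x y \<alpha>. T (\<lambda>g. x g + \<alpha> * y g) = (\<lambda>g. T x g + \<alpha> * T y g)"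
begin

lemma resolution_pvm: "projection_valued_measure E"
  using res unfolding spectral_resolution_def by blast

lemmas pvm_facts = pvm_ell2[OF resolution_pvm] pvm_add[OF resolution_pvm]
  pvm_scale[OF resolution_pvm] pvm_Int[OF resolution_pvm] pvm_empty[OF resolution_pvm]

lemma integrable_id_spectral_measure_at:
  assumes "x \<in> ell2"
  shows "integrable (spectral_measure_at E x) (\<lambda>t. t)"
proof (rule Bochner_Integration.integrable_bound)
  interpret finite_measure "spectral_measure_at E x"
    by (rule finite_measure_spectral_measure_at[OF resolution_pvm assms])
  show "integrable (spectral_measure_at E x) (\<lambda>t. 1 + t\<^sup>2)"
    using res assms unfolding spectral_resolution_def by auto
  have "\<bar>t\<bar> \<le> 1 + t\<^sup>2" for t :: real
  proof (cases "\<bar>t\<bar> \<le> 1")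
    case False
    then have "\<bar>t\<bar> * 1 \<le> \<bar>t\<bar> * \<bar>t\<bar>" by (intro mult_left_mono) auto
    then show ?thesis by (simp add: power2_eq_square)
  qed (use zero_le_power2[of t] in linarith)
  then show "AE t in spectral_measure_at E x. norm t \<le> norm (1 + t\<^sup>2)"
    by (auto intro!: AE_I2 order_trans[OF _ abs_ge_self])
qed (simp add: measurable_cong_sets[OF sets_spectral_measure_at[OF resolution_pvm] refl])

lemma integrable_indicator_id_spectral_measure_at:
  assumes "x \<in> ell2" "A \<in> sets borel"
  shows "integrable (spectral_measure_at E x) (\<lambda>t. indicator A t * t)"
  using integrable_mult_indicator[of A "spectral_measure_at E x" "\<lambda>t. t"] assms
    integrable_id_spectral_measure_at
  by (simp add: sets_spectral_measure_at[OF resolution_pvm])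

lemma borel_measurable_spectral_measure_at:
  "f \<in> borel_measurable borel \<Longrightarrow> f \<in> borel_measurable (spectral_measure_at E x)"
  by (simp add: measurable_cong_sets[OF sets_spectral_measure_at[OF resolution_pvm] refl])

lemma quadratic_form_pvm:
  assumes "A \<in> sets borel" "x \<in> ell2"
  shows "ell2_inner (T (E A x)) (E A x) =
    of_real (\<integral>t. indicator A t * t \<partial>spectral_measure_at E x)"
proof -
  have "ell2_inner (T (E A x)) (E A x) = of_real (\<integral>t. t \<partial>spectral_measure_at E (E A x))"
    using res assms pvm_facts(1) unfolding spectral_resolution_def by blast
  also have "(\<integral>t. t \<partial>spectral_measure_at E (E A x)) =
      (\<integral>t. indicator A t * t \<partial>spectral_measure_at E x)"
    unfolding spectral_measure_at_pvm[OF resolution_pvm assms(2,1)]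
    using assms by (subst integral_density) (auto intro!: borel_measurable_spectral_measure_at)
  finally show ?thesis .
qed

text \<open>The quadratic form of \<open>T\<close> splits along \<open>A\<close> and its complement; by polarization so does \<open>T\<close>.\<close>

lemma pvm_no_cross_term:
  assumes A: "A \<in> sets borel" and x: "x \<in> ell2" "E A x = x" and y: "y \<in> ell2" "E (- A) y = y"
  shows "ell2_inner (T x) y = 0"
proof -
  have Ay: "E A y = (\<lambda>_. 0)"
  proof -
    have "E A (E (- A) y) = E (A \<inter> - A) y" using A y by (intro pvm_facts) auto
    then show ?thesis using y by (simp add: pvm_facts)
  qed
  have Ax: "E (- A) x = (\<lambda>_. 0)"
  proof -
    have "E (- A) (E A x) = E (- A \<inter> A) x" using A x by (intro pvm_facts) auto
    then show ?thesis using x by (simp add: pvm_facts)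
  qed
  \<comment> \<open>The quadratic form at z = x + \<alpha> y is computed twice: by splitting the
    integral over \<open>A\<close> and its complement, and by expanding the inner product. The
    difference is the pair of cross terms.\<close>
  have cross: "cnj \<alpha> * ell2_inner (T x) y + \<alpha> * ell2_inner (T y) x = 0" for \<alpha>
  proof -
    define v where "v g = \<alpha> * y g" for g
    define z where "z g = x g + v g" for g
    have v_eq: "v = (\<lambda>g. \<alpha> * y g)" and z_eq: "z = (\<lambda>g. x g + v g)"
      by (simp_all add: v_def z_def fun_eq_iff)
    have v: "v \<in> ell2" and z: "z \<in> ell2"
      unfolding v_eq z_eq using x y by (auto intro!: ell2_add ell2_scale)
    have "E A v = (\<lambda>_. 0)" "E (- A) v = v"
      unfolding v_eq using A y Ay by (simp_all add: pvm_facts)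
    then have Ez: "E A z = x" "E (- A) z = v"
      unfolding z_eq using A x v Ax by (simp_all add: pvm_facts)
    have "ell2_inner (T z) z = of_real (\<integral>t. t \<partial>spectral_measure_at E z)"
      using res z unfolding spectral_resolution_def by blast
    also have "(\<integral>t. t \<partial>spectral_measure_at E z) =
        (\<integral>t. indicator A t * t + indicator (- A) t * t \<partial>spectral_measure_at E z)"
      by (intro Bochner_Integration.integral_cong) (auto simp: indicator_def)
    also have "\<dots> = (\<integral>t. indicator A t * t \<partial>spectral_measure_at E z) +
        (\<integral>t. indicator (- A) t * t \<partial>spectral_measure_at E z)"
      using A z
      by (intro Bochner_Integration.integral_add integrable_indicator_id_spectral_measure_at) auto
    also have "of_real \<dots> = ell2_inner (T x) x + ell2_inner (T v) v"
      using quadratic_form_pvm[OF A z] quadratic_form_pvm[of "- A" z] A z by (simp add: Ez)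
    finally have 1: "ell2_inner (T z) z = ell2_inner (T x) x + ell2_inner (T v) v" .
    have "T z = (\<lambda>g. T x g + \<alpha> * T y g)"
      unfolding z_eq v_eq by (rule T_linear)
    moreover have "T v = (\<lambda>g. \<alpha> * T y g)"
    proof -
      \<comment> \<open>Linearity is only given in the form x + \<alpha> y, so T 0 = 0 comes from T
        0 = T 0 + T 0.\<close>
      have "T (\<lambda>g. 0 + 1 * 0) = (\<lambda>g. T (\<lambda>g. 0) g + 1 * T (\<lambda>g. 0) g)" by (rule T_linear)
      then have "T (\<lambda>g. 0) = (\<lambda>g. 0)" by (simp add: fun_eq_iff)
      then show ?thesis using T_linear[of "\<lambda>g. 0" \<alpha> y] by (simp add: v_eq)
    qed
    ultimately have "ell2_inner (T z) z = ell2_inner (T x) x + ell2_inner (T v) v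
        + (cnj \<alpha> * ell2_inner (T x) y + \<alpha> * ell2_inner (T y) x)"
      using x y v z T_ell2
      by (subst (2) z_eq) (simp add: v_eq ell2_inner_add_left ell2_inner_add_right ell2_inner_scale_left
          ell2_inner_scale_right ell2_scale ell2_add algebra_simps)
    with 1 show ?thesis by simp
  qed
  \<comment> \<open>With \<alpha> = 1 the two inner products are negatives of each other, with
    \<alpha> = i they are equal; so both vanish.\<close>
  show ?thesis
    using cross[of 1] cross[of \<i>] by (simp add: algebra_simps complex_eq_iff)
qed

text \<open>For \<open>x = E A v\<close> the absence of cross terms gives <Tx, x> = s <x, x>. Since
  <x, x> is the mass of \<open>A\<close>, the integral of t - s over \<open>A\<close> is 0; as t - s
  has a strict constant sign on \<open>A\<close>, that mass is 0.\<close>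

lemma pvm_eigenvector_zero:
  assumes v: "v \<in> ell2" "T v = (\<lambda>g. of_real s * v g)" and A: "A \<in> sets borel"
    and sign: "(\<forall>t\<in>A. t > s) \<or> (\<forall>t\<in>A. t < s)"
  shows "E A v = (\<lambda>_. 0)"
proof -
  define x where "x = E A v"
  define y where "y = E (- A) v"
  let ?M = "spectral_measure_at E v"
  have x: "x \<in> ell2" "E A x = x" and y: "y \<in> ell2" "E (- A) y = y"
    using v A by (simp_all add: x_def y_def pvm_facts)
  have xy: "v = (\<lambda>g. x g + 1 * y g)"
    using pvm_compl[OF resolution_pvm A v(1)] by (simp add: x_def y_def)
  \<comment> \<open>The roles are exchanged here: \<open>y\<close> belongs to \<open>- A\<close> and
    \<open>x\<close> to the complement of \<open>- A\<close>.\<close>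
  have cross: "ell2_inner (T y) x = 0"
    using A x y by (intro pvm_no_cross_term[of "- A"]) auto
  have vx: "ell2_inner v x = ell2_inner x x"
    using pvm_inner[OF resolution_pvm A v(1)] ell2_inner_commute[of v x] ell2_inner_self_real[of x]
    unfolding x_def by (metis complex_cnj_complex_of_real)
  have "ell2_inner (T v) x = ell2_inner (T x) x"
    using x y cross T_ell2
    by (subst xy, subst T_linear) (simp add: ell2_inner_add_left)
  then have Tx: "ell2_inner (T x) x = of_real s * ell2_inner x x"
    by (simp add: v(2) ell2_inner_scale_left vx)
  interpret finite_measure ?M
    by (rule finite_measure_spectral_measure_at[OF resolution_pvm v(1)])
  have sets: "sets ?M = sets borel" by (rule sets_spectral_measure_at[OF resolution_pvm])
  have meas: "measure ?M A = Re (ell2_inner x x)"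
    unfolding measure_def emeasure_spectral_measure_at[OF resolution_pvm v(1) A] x_def
      pvm_inner[OF resolution_pvm A v(1)]
    using pvm_nonneg[OF resolution_pvm A v(1)] by simp
  have int: "integrable ?M (\<lambda>t. indicator A t * t)" "integrable ?M (\<lambda>t. indicator A t * s)"
    using A sets integrable_indicator_id_spectral_measure_at[OF v(1)]
    by (auto intro!: integrable_real_indicator integrable_mult_left simp: emeasure_finite less_top[symmetric])
  have "(\<integral>t. indicator A t * (t - s) \<partial>?M) = (\<integral>t. indicator A t * t \<partial>?M) - (\<integral>t. indicator A t * s \<partial>?M)"
    using int by (subst Bochner_Integration.integral_diff[symmetric]) (auto simp: algebra_simps)
  also have "(\<integral>t. indicator A t * t \<partial>?M) = s * Re (ell2_inner x x)"
    using arg_cong[OF Tx, of Re] quadratic_form_pvm[OF A v(1)] ell2_inner_self_real[of x]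
    by (simp add: x_def)
  also have "(\<integral>t. indicator A t * s \<partial>?M) = s * Re (ell2_inner x x)"
    using A sets meas by (simp add: mult.commute[of _ s])
  finally have 0: "(\<integral>t. indicator A t * (t - s) \<partial>?M) = 0" by simp
  have int': "integrable ?M (\<lambda>t. indicator A t * (t - s))"
    using Bochner_Integration.integrable_diff[OF int] by (simp add: algebra_simps)
  have "AE t in ?M. indicator A t * (t - s) = 0"
    using sign
  proof
    assume "\<forall>t\<in>A. t > s"
    then have "AE t in ?M. 0 \<le> indicator A t * (t - s)"
      by (intro AE_I2) (auto simp: indicator_def less_imp_le)
    then show ?thesis
      using 0 integral_nonneg_eq_0_iff_AE[OF int'] by blast
  next
    assume "\<forall>t\<in>A. t < s"
    then have "AE t in ?M. 0 \<le> - (indicator A t * (t - s))"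
      by (intro AE_I2) (auto simp: indicator_def less_imp_le)
    then have "AE t in ?M. - (indicator A t * (t - s)) = 0"
      using 0 integral_nonneg_eq_0_iff_AE[OF Bochner_Integration.integrable_minus[OF int']] by simp
    then show ?thesis by simp
  qed
  then have "AE t in ?M. t \<notin> A"
    by (rule AE_mp) (use sign in \<open>auto intro!: AE_I2 simp: indicator_def\<close>)
  then have "measure ?M A = 0"
    using A sets by (subst (asm) AE_iff_measurable[of A])
      (auto simp: measure_def space_spectral_measure_at[OF resolution_pvm])
  then show ?thesis
    using x meas by (intro ell2_inner_self_eq_0) (auto simp: x_def)
qed

text \<open>Both open half-lines at \<open>s\<close> annihilate \<open>v\<close>, so
  \<open>v\<close> is fixed by \<open>E {s}\<close>, and \<open>B \<inter> {s}\<close> is either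
  \<open>{s}\<close> or empty.\<close>

lemma pvm_eigenvector:
  assumes v: "v \<in> ell2" "T v = (\<lambda>g. of_real s * v g)" and B: "B \<in> sets borel"
  shows "E B v = (if s \<in> B then v else (\<lambda>_. 0))"
proof -
  have 1: "E (- {s..}) v = (\<lambda>_. 0)" and 2: "E {s<..} v = (\<lambda>_. 0)"
    by (rule pvm_eigenvector_zero[OF v]; auto)+
  have 3: "E {s..} v = v"
    using 1 v by (subst (asm) pvm_compl[OF resolution_pvm]) (auto simp: fun_eq_iff)
  have 4: "E {..s} v = v"
    using pvm_compl[OF resolution_pvm, of "{s<..}" v] 2 v by (simp add: fun_eq_iff)
  have "E {..s} (E {s..} v) = E ({..s} \<inter> {s..}) v"
    using v by (intro pvm_facts) auto
  moreover have "{..s} \<inter> {s..} = {s}" by auto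
  ultimately have s: "E {s} v = v" by (simp add: 3 4)
  have "E B (E {s} v) = E (B \<inter> {s}) v"
    using v B by (intro pvm_facts) auto
  then show ?thesis
    using v s by (auto simp: pvm_facts)
qed

end

text \<open>Bessel's inequality for the vector \<open>E B x\<close>, whose coefficients at eigenvectors are known.\<close>

lemma spectral_measure_ge_eigenvectors:
  assumes "spectral_resolution T E" "\<And>x. x \<in> ell2 \<Longrightarrow> T x \<in> ell2"
    and "\<And>x y \<alpha>. T (\<lambda>g. x g + \<alpha> * y g) = (\<lambda>g. T x g + \<alpha> * T y g)"
    and "finite I" "x \<in> ell2" "\<And>i. i \<in> I \<Longrightarrow> w i \<in> ell2"
    and eig: "\<And>i. i \<in> I \<Longrightarrow> T (w i) = (\<lambda>g. of_real (s i) * w i g)"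
    and "\<And>i j. i \<in> I \<Longrightarrow> j \<in> I \<Longrightarrow> i \<noteq> j \<Longrightarrow> ell2_inner (w i) (w j) = 0"
    and "\<And>i. i \<in> I \<Longrightarrow> Re (ell2_inner (w i) (w i)) > 0"
    and B: "B \<in> sets borel"
  shows "(\<Sum>i\<in>I. (cmod (ell2_inner x (w i)))\<^sup>2 / Re (ell2_inner (w i) (w i)) * indicator B (s i))
    \<le> Re (ell2_inner (E B x) x)"
proof -
  have pvm: "projection_valued_measure E"
    using assms(1) unfolding spectral_resolution_def by blast
  \<comment> \<open>Self-adjointness moves \<open>E B\<close> to the eigenvector, which it either
    fixes or annihilates.\<close>
  have "ell2_inner (E B x) (w i) = ell2_inner x (w i) * indicator B (s i)" if "i \<in> I" for i
    using assms that
    by (simp add: pvm_selfadjoint[OF pvm] pvm_eigenvector[OF assms(1-3) _ eig[OF that]])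
  then have "(\<Sum>i\<in>I. (cmod (ell2_inner x (w i)))\<^sup>2 / Re (ell2_inner (w i) (w i)) * indicator B (s i))
    = (\<Sum>i\<in>I. (cmod (ell2_inner (E B x) (w i)))\<^sup>2 / Re (ell2_inner (w i) (w i)))"
    by (intro sum.cong) (auto simp: indicator_def)
  also have "\<dots> \<le> Re (ell2_inner (E B x) (E B x))"
    using assms by (intro ell2_bessel pvm_ell2[OF pvm]) auto
  finally show ?thesis
    using assms by (simp add: pvm_inner[OF pvm])
qed

section \<open>Chebyshev polynomials and the zeros of \<open>G\<^sub>k\<close>\<close>

text \<open>The values of the second-kind polynomials over any commutative ring, since both real and
  complex arguments occur below.\<close>

fun cheb :: "nat \<Rightarrow> 'a::comm_ring_1 \<Rightarrow> 'a" where
  "cheb 0 x = 1"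
| "cheb (Suc 0) x = 2 * x"
| "cheb (Suc (Suc n)) x = 2 * x * cheb (Suc n) x - cheb n x"

lemma poly_chebyshev_U: "poly (chebyshev_U n) x = cheb n x"
  by (induction n rule: chebyshev_U.induct) (auto simp: algebra_simps)

text \<open>Parity reconciles the argument (-z - \<mu>)/4 in \<open>G_poly\<close> with the argument
  (z + \<mu>)/4 in the eigenvectors.\<close>

lemma cheb_minus: "cheb n (- x) = (- 1) ^ n * cheb n x"
  by (induction n x rule: cheb.induct) (auto simp: algebra_simps)

lemma cnj_cheb: "cnj (cheb n z) = cheb n (cnj z)"
  by (induction n z rule: cheb.induct) auto

text \<open>Used twice: for two zeros it gives orthogonality of the Jacobi eigenvectors, and for a
  conjugate pair it shows that the zeros are real.\<close>

lemma christoffel_darboux: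
  "2 * (x - y) * (\<Sum>i\<le>n. cheb i x * cheb i y) =
     cheb (Suc n) x * cheb n y - cheb n x * cheb (Suc n) y"
  by (induction n) (simp_all add: algebra_simps)

text \<open>The limit y -> x of the previous identity, stated for polynomials and proved by
  induction with the differentiated recurrence.\<close>

lemma christoffel_darboux_confluent:
  "2 * (\<Sum>i\<le>n. (chebyshev_U i)\<^sup>2) =
     pderiv (chebyshev_U (Suc n)) * chebyshev_U n - pderiv (chebyshev_U n) * chebyshev_U (Suc n)"
proof (induction n)
  case (Suc n)
  have "pderiv (chebyshev_U (Suc (Suc n))) =
      2 * chebyshev_U (Suc n) + [:0, 2:] * pderiv (chebyshev_U (Suc n)) - pderiv (chebyshev_U n)"
    by (simp add: pderiv_diff pderiv_mult pderiv_pCons pderiv_smult numeral_poly one_pCons)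
  moreover have "chebyshev_U (Suc (Suc n)) = [:0, 2:] * chebyshev_U (Suc n) - chebyshev_U n"
    by simp
  ultimately show ?case
    using Suc unfolding sum.atMost_Suc by algebra
qed (simp_all add: pderiv_pCons one_pCons numeral_poly power2_eq_square)

section \<open>Degree, simplicity and reality of the zeros of \<open>G_poly\<close>\<close>

lemma poly_G_poly_Suc:
  "poly (G_poly (Suc n) \<mu>) z =
     2 ^ Suc n * (cheb (Suc n) ((- z - \<mu>) / 4) + \<mu> * cheb n ((- z - \<mu>) / 4))"
proof -
  have "- \<mu> / 4 + z * (- 1 / 4) = (- z - \<mu>) / 4" by (simp add: field_simps)
  then show ?thesis
    by (simp only: G_poly_def poly_smult poly_add poly_pcompose poly_chebyshev_U poly_pCons
        poly_0 mult_zero_right add_0_right diff_Suc_1)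
qed

lemma degree_chebyshev_U [simp]: "degree (chebyshev_U n) = n"
proof (induction n rule: chebyshev_U.induct)
  case (3 n)
  have "chebyshev_U (Suc n) \<noteq> 0"
    using 3(1) by auto
  then have "degree ([:0, 2:] * chebyshev_U (Suc n)) = Suc (Suc n)"
    using 3(1) by (subst degree_mult_eq) auto
  then show ?case
    using 3(2) \<open>degree ([:0, 2:] * chebyshev_U (Suc n)) = Suc (Suc n)\<close>
    unfolding chebyshev_U.simps by (metis less_Suc_eq lessI degree_add_eq_left degree_minus diff_conv_add_uminus)
qed auto

lemma degree_G_poly_Suc: "degree (G_poly (Suc n) \<mu>) = Suc n"
proof -
  have "degree (pcompose (chebyshev_U (Suc n)) [:- \<mu> / 4, - 1 / 4:]
        + smult \<mu> (pcompose (chebyshev_U n) [:- \<mu> / 4, - 1 / 4:])) = Suc n"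
    by (subst degree_add_eq_left) (auto simp: degree_pcompose degree_chebyshev_U intro: le_less_trans[OF degree_smult_le])
  then show ?thesis by (simp add: G_poly_def)
qed

lemma G_poly_nonzero: "G_poly (Suc n) \<mu> \<noteq> 0"
  using degree_G_poly_Suc[of n \<mu>] by auto

text \<open>At a double zero U_(n+1) + \<mu> U_n and its derivative both vanish. Eliminating \<mu>
  kills the right side of the confluent identity, so a sum of squares containing U_0 = 1 would be
  0.\<close>

lemma simple_root_G_poly:
  assumes "poly (G_poly (Suc n) \<mu>) z = 0"
  shows "poly (pderiv (G_poly (Suc n) \<mu>)) z \<noteq> 0"
proof
  assume d: "poly (pderiv (G_poly (Suc n) \<mu>)) z = 0"
  define y where "y = (- z - \<mu>) / 4"
  define U U' where "U k = poly (chebyshev_U k) y" and "U' k = poly (pderiv (chebyshev_U k)) y" for k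
  have "U (Suc n) + \<mu> * U n = 0"
    using assms by (simp add: poly_G_poly_Suc U_def poly_chebyshev_U y_def)
  moreover have "U' (Suc n) + \<mu> * U' n = 0"
  proof -
    have "- \<mu> / 4 + z * (- 1 / 4) = y" by (simp add: y_def field_simps)
    then have "poly (pderiv (G_poly (Suc n) \<mu>)) z = 2 ^ Suc n * (- 1 / 4) * (U' (Suc n) + \<mu> * U' n)"
      unfolding G_poly_def U'_def
      by (simp add: pderiv_smult pderiv_add pderiv_pcompose pderiv_pCons poly_pcompose
          algebra_simps del: chebyshev_U.simps)
    with d show ?thesis by simp
  qed
  ultimately have "U' (Suc n) * U n - U' n * U (Suc n) = 0"
    by algebra
  moreover have "poly (2 * (\<Sum>i\<le>n. (chebyshev_U i)\<^sup>2)) y = U' (Suc n) * U n - U' n * U (Suc n)"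
    by (subst christoffel_darboux_confluent) (simp add: U_def U'_def)
  ultimately have "(\<Sum>i\<le>n. (U i)\<^sup>2) = 0"
    by (simp add: poly_sum U_def)
  then have "U 0 = 0"
    by (subst (asm) sum_nonneg_eq_0_iff) auto
  then show False by (simp add: U_def)
qed

text \<open>Needed to count zeros over the complex numbers, where the polynomial splits. The
  recurrence is carried through the composition as \<open>V\<close>.\<close>

lemma poly_map_of_real_chebyshev_U_pcompose:
  fixes z :: complex
  shows "poly (map_poly of_real (pcompose (chebyshev_U n) [:b, c:])) z = cheb n (of_real b + z * of_real c)"
proof (induction n rule: chebyshev_U.induct)
  case (3 n)
  define V where "V n = pcompose (chebyshev_U n) [:b, c:]" for n
  have hom: "map_poly of_real (p - q) = (map_poly of_real p - map_poly of_real q :: complex poly)"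
    "map_poly of_real (p + q) = (map_poly of_real p + map_poly of_real q :: complex poly)"
    "map_poly of_real (smult a p) = (smult (of_real a) (map_poly of_real p) :: complex poly)"
    for p q :: "real poly" and a
    by (auto intro!: poly_eqI simp: coeff_map_poly)
  have V: "V (Suc (Suc n)) = smult (2 * b) (V (Suc n)) + pCons 0 (smult (2 * c) (V (Suc n))) - V n"
    unfolding V_def by (simp add: pcompose_diff pcompose_mult pcompose_pCons pcompose_smult smult_add_right algebra_simps)
  have "poly (map_poly of_real (V (Suc (Suc n)))) z =
      2 * (of_real b + z * of_real c) * poly (map_poly of_real (V (Suc n))) z - poly (map_poly of_real (V n)) z"
    unfolding V by (simp add: hom map_poly_pCons algebra_simps)
  then show ?case
    using 3 unfolding V_def by simp
qed (simp_all add: map_poly_pCons pcompose_pCons one_pCons algebra_simps)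

lemma poly_map_of_real_G_poly_Suc:
  fixes z :: complex
  shows "poly (map_poly of_real (G_poly (Suc n) \<mu>)) z =
     2 ^ Suc n * (cheb (Suc n) ((- z - of_real \<mu>) / 4) + of_real \<mu> * cheb n ((- z - of_real \<mu>) / 4))"
proof -
  have "map_poly of_real (G_poly (Suc n) \<mu>) = (smult (2 ^ Suc n)
       (map_poly of_real (pcompose (chebyshev_U (Suc n)) [:- \<mu> / 4, - 1 / 4:])
        + smult (of_real \<mu>) (map_poly of_real (pcompose (chebyshev_U n) [:- \<mu> / 4, - 1 / 4:]))) :: complex poly)"
    unfolding G_poly_def by (rule poly_eqI) (simp add: coeff_map_poly)
  then show ?thesis
    by (simp add: poly_map_of_real_chebyshev_U_pcompose algebra_simps diff_divide_distrib add_divide_distrib del: power_Suc)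
qed

text \<open>With \<open>y\<close> its conjugate satisfies the same relation, since \<mu> is real.
  For non-real \<open>y\<close>, Christoffel-Darboux then makes the sum of all |U_i(y)|^2 vanish,
  although U_0 = 1.\<close>

lemma real_roots_G_poly:
  fixes z :: complex
  assumes "poly (map_poly of_real (G_poly (Suc n) \<mu>)) z = 0"
  shows "z \<in> \<real>"
proof (rule ccontr)
  assume "z \<notin> \<real>"
  define y where "y = (- z - of_real \<mu>) / 4"
  have "cheb (Suc n) y + of_real \<mu> * cheb n y = 0"
    using assms by (simp add: poly_map_of_real_G_poly_Suc y_def)
  moreover from this have "cnj (cheb (Suc n) y + of_real \<mu> * cheb n y) = 0"
    by simp
  then have "cheb (Suc n) (cnj y) + of_real \<mu> * cheb n (cnj y) = 0"
    by (simp add: cnj_cheb)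
  ultimately have "cheb (Suc n) y * cheb n (cnj y) - cheb n y * cheb (Suc n) (cnj y) = 0"
    by algebra
  then have "2 * (y - cnj y) * (\<Sum>i\<le>n. cheb i y * cheb i (cnj y)) = 0"
    by (simp only: christoffel_darboux)
  moreover have "y \<noteq> cnj y"
  proof
    assume *: "y = cnj y"
    have "z = - 4 * y - of_real \<mu>" by (simp add: y_def field_simps)
    moreover have "y \<in> \<real>" using * by (metis Reals_cnj_iff)
    ultimately show False using \<open>z \<notin> \<real>\<close> by simp
  qed
  ultimately have "(\<Sum>i\<le>n. cheb i y * cheb i (cnj y)) = 0" by simp
  then have "(\<Sum>i\<le>n. of_real ((cmod (cheb i y))\<^sup>2)) = (0::complex)"
    by (simp add: complex_norm_square cnj_cheb del: of_real_power)
  then have "(\<Sum>i\<le>n. (cmod (cheb i y))\<^sup>2) = 0"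
    by (metis of_real_sum of_real_eq_0_iff)
  then have "\<forall>i\<in>{..n}. (cmod (cheb i y))\<^sup>2 = 0"
    by (subst (asm) sum_nonneg_eq_0_iff) auto
  then have "(cmod (cheb 0 y))\<^sup>2 = 0"
    by blast
  then show False by simp
qed

lemma rsquarefree_G_poly: "rsquarefree (G_poly (Suc n) \<mu>)"
  using simple_root_G_poly by (auto simp: rsquarefree_roots)

text \<open>The complexification \<open>H\<close> is squarefree, hence a constant times the product
  of the linear factors of its distinct zeros; all of these are real, so their number is the
  degree.\<close>

lemma card_roots_G_poly: "card {s. poly (G_poly (Suc n) \<mu>) s = 0} = Suc n"
proof -
  define G where "G = G_poly (Suc n) \<mu>"
  define H where "H = (map_poly of_real G :: complex poly)"
  have ev: "poly (map_poly of_real p) (of_real x) = (of_real (poly p x) :: complex)" for p x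
    by (induction p) (auto simp: map_poly_pCons)
  have der: "pderiv H = map_poly of_real (pderiv G)"
    unfolding H_def by (rule poly_eqI) (simp add: coeff_map_poly coeff_pderiv)
  have roots: "{z. poly H z = 0} = of_real ` {s. poly G s = 0}"
    using real_roots_G_poly by (force simp: H_def G_def ev elim!: Reals_cases)
  have "rsquarefree H"
    unfolding rsquarefree_roots
  proof (intro allI notI)
    fix z assume *: "poly H z = 0 \<and> poly (pderiv H) z = 0"
    then obtain s where "z = of_real s" "poly G s = 0" using roots by blast
    with * show False using simple_root_G_poly[of n \<mu> s] by (simp add: der ev G_def)
  qed
  then have *: "smult (lead_coeff H) (\<Prod>z|poly H z = 0. [:-z, 1:]) = H"
    by (rule complex_poly_decompose_rsquarefree)
  have dH: "degree H = Suc n"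
    by (simp add: H_def G_def degree_map_poly degree_G_poly_Suc)
  then have "H \<noteq> 0" by auto
  have "degree (\<Prod>z|poly H z = 0. [:-z, 1:]) = card {z. poly H z = 0}"
    by (subst degree_prod_eq_sum_degree) auto
  then have "degree H = card {z. poly H z = 0}"
    by (subst * [symmetric]) (use \<open>H \<noteq> 0\<close> in simp)
  then show ?thesis
    unfolding roots by (simp add: dH card_image inj_on_def G_def)
qed

section \<open>Eigenvectors of the lamplighter operator\<close>

lemma conv_operator_superset:
  assumes "finite K" "Poly_Mapping.keys u \<subseteq> K"
  shows "conv_operator G u x g = (\<Sum>h\<in>K. Poly_Mapping.lookup u h * left_regular G h x g)"
  unfolding conv_operator_def using assms
  by (intro sum.mono_neutral_left) (auto simp: in_keys_iff)

text \<open>Cancellation can make \<open>keys (u + v)\<close> smaller than the union of the keys, so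
  all three sums are taken over that union.\<close>

lemma conv_operator_add:
  "conv_operator G (u + v) x g = conv_operator G u x g + conv_operator G v x g"
  by (subst (1 2 3) conv_operator_superset[where K = "Poly_Mapping.keys u \<union> Poly_Mapping.keys v"])
    (auto simp: lookup_add distrib_right sum.distrib dest: subsetD[OF keys_add])

lemma conv_operator_diff:
  "conv_operator G (u - v) x g = conv_operator G u x g - conv_operator G v x g"
  by (subst (1 2 3) conv_operator_superset[where K = "Poly_Mapping.keys u \<union> Poly_Mapping.keys v"])
    (auto simp: lookup_minus left_diff_distrib sum_subtractf dest: subsetD[OF keys_diff])

lemma conv_operator_single:
  "conv_operator G (Poly_Mapping.single h c) x g = c * left_regular G h x g"
  by (subst conv_operator_superset[where K = "{h}"]) auto

lemma conv_operator_linear: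
  "conv_operator G u (\<lambda>g. x g + \<alpha> * y g) = (\<lambda>g. conv_operator G u x g + \<alpha> * conv_operator G u y g)"
  by (simp add: conv_operator_def left_regular_def fun_eq_iff algebra_simps sum.distrib sum_distrib_left)

lemma conv_operator_ell2:
  assumes "group G" "carrier G = UNIV" "x \<in> ell2"
  shows "conv_operator G u x \<in> ell2"
proof -
  interpret group G by fact
  have "left_regular G h x \<in> ell2" for h
  proof -
    have "bij (\<lambda>g. inv\<^bsub>G\<^esub> h \<otimes>\<^bsub>G\<^esub> g)"
      by (rule bij_betw_byWitness[where f' = "\<lambda>g. h \<otimes>\<^bsub>G\<^esub> g"]) (auto simp: m_assoc[symmetric] assms(2))
    then show ?thesis
      using assms(3) summable_on_reindex_bij_betw[of "\<lambda>g. inv\<^bsub>G\<^esub> h \<otimes>\<^bsub>G\<^esub> g" UNIV UNIV "\<lambda>g. (cmod (x g))\<^sup>2"]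
      by (simp add: ell2_def left_regular_def)
  qed
  then show ?thesis
    unfolding conv_operator_def[abs_def] by (intro ell2_sum ell2_scale)
qed

section \<open>The lamplighter group and its operator in coordinates\<close>

lemma carrier_lamplighter [simp]: "carrier lamplighter = UNIV"
  by (simp add: lamplighter_def)

lemma lamplighter_mult [simp]: "(f, m) \<otimes>\<^bsub>lamplighter\<^esub> (g, n) = (f + shift m g, m + n)"
  by (simp add: lamplighter_def)

lemma lamplighter_one: "\<one>\<^bsub>lamplighter\<^esub> = (0, 0)"
  by (simp add: lamplighter_def)

lemma shift_simps [simp]:
  "shift 0 f = f" "shift n 0 = 0" "shift n (f + g) = shift n f + shift n g"
  "shift n (Poly_Mapping.single i c) = Poly_Mapping.single (i + n) c"
  "shift m (shift n f) = shift (m + n) f"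
  by (rule poly_mapping_eqI; auto simp: lookup_shift lookup_add lookup_single when_def algebra_simps)+

definition lamp :: "int \<Rightarrow> int \<Rightarrow>\<^sub>0 bit" where
  "lamp i = Poly_Mapping.single i 1"

lemma lookup_lamp: "Poly_Mapping.lookup (lamp i) j = (if i = j then 1 else 0)"
  by (simp add: lamp_def lookup_single)

lemma shift_lamp [simp]: "shift n (lamp i) = lamp (i + n)"
  by (simp add: lamp_def)

lemma lamp_add_self [simp]: "lamp i + (lamp i + f) = f"
proof (rule poly_mapping_eqI)
  fix j
  have "b + (b + c) = c" for b c :: bit
    by (cases b; cases c) auto
  then show "Poly_Mapping.lookup (lamp i + (lamp i + f)) j = Poly_Mapping.lookup f j"
    by (simp only: lookup_add)
qed

lemma two_lamp [simp]: "2 * lamp i = 0"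
  using lamp_add_self[of i 0] by (simp only: mult_2 add_0_right)

lemma gen_c_lamp: "gen_c = (lamp 0, 0)"
  by (simp add: gen_c_def lamp_def)

lemma gen_b_lamp: "gen_b = (lamp 1, 1)"
  by (simp add: gen_b_def gen_a_def gen_c_lamp)

lemma lamplighter_inv:
  "inv\<^bsub>lamplighter\<^esub> (0, 1) = (0, - 1)"
  "inv\<^bsub>lamplighter\<^esub> (0, - 1) = (0, 1)"
  "inv\<^bsub>lamplighter\<^esub> (lamp 1, 1) = (lamp 0, - 1)"
  "inv\<^bsub>lamplighter\<^esub> (lamp 0, - 1) = (lamp 1, 1)"
  "inv\<^bsub>lamplighter\<^esub> (lamp 0, 0) = (lamp 0, 0)"
  by (rule group.inv_equality[OF group_lamplighter]; simp add: lamplighter_one)+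

text \<open>The five arguments are the products of the inverses of a, a^-1, b, b^-1, c, in this
  order, with (f, n). The fourth lamp part is \<open>lamp 1 + shift 1 f\<close>, kept as a shift to
  match \<open>boundary_sign_shift\<close>.\<close>

lemma lamplighter_operator_apply:
  "lamplighter_operator \<mu> x (f, n) =
     x (shift (- 1) f, n - 1) + x (shift 1 f, n + 1) +
     x (lamp 0 + shift (- 1) f, n - 1) + x (shift 1 (lamp 0 + f), n + 1) - \<mu> * x (lamp 0 + f, n)"
  unfolding lamplighter_operator_def conv_operator_add conv_operator_diff conv_operator_single left_regular_def
    gen_a_def gen_b_lamp gen_c_lamp lamplighter_inv
  by (simp add: algebra_simps)

lemma lamplighter_operator_linear:
  "lamplighter_operator \<mu> (\<lambda>g. x g + \<alpha> * y g) =
    (\<lambda>g. lamplighter_operator \<mu> x g + \<alpha> * lamplighter_operator \<mu> y g)"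
  unfolding lamplighter_operator_def by (rule conv_operator_linear)

lemma lamplighter_operator_ell2: "x \<in> ell2 \<Longrightarrow> lamplighter_operator \<mu> x \<in> ell2"
  unfolding lamplighter_operator_def by (intro conv_operator_ell2 group_lamplighter) auto

text \<open>
  \<open>path_vector l r y\<close> lives on the path with vertices \<open>-l..r\<close>.  At vertex \<open>n\<close> the \<open>l + r + 2\<close> projections
  that fix this path concern the lamps in \<open>window l r n\<close>: the two at its ends are 0 (closed edges, hence
  the signs) and the others are 1.  The entries of the Jacobi eigenvector are \<open>path_weight\<close>.
\<close>

definition lit_within :: "int set \<Rightarrow> (int \<Rightarrow>\<^sub>0 bit) set" where
  "lit_within W = {f. \<forall>i. Poly_Mapping.lookup f i \<noteq> 0 \<longrightarrow> i \<in> W}"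

text \<open>A function with values in \<open>bit\<close> is determined by its support; this gives
  the count of configurations.\<close>

lemma bij_betw_keys_lit_within:
  assumes "finite W"
  shows "bij_betw Poly_Mapping.keys (lit_within W) (Pow W)"
proof (rule bij_betw_imageI)
  have "f = g" if "Poly_Mapping.keys f = Poly_Mapping.keys g" for f g :: "int \<Rightarrow>\<^sub>0 bit"
  proof (rule poly_mapping_eqI)
    fix i
    have "Poly_Mapping.lookup f i = 0 \<longleftrightarrow> Poly_Mapping.lookup g i = 0"
      using that by (metis in_keys_iff)
    then show "Poly_Mapping.lookup f i = Poly_Mapping.lookup g i"
      by (metis bit_not_zero_iff)
  qed
  then show "inj_on Poly_Mapping.keys (lit_within W)" by (auto intro: inj_onI)
  show "Poly_Mapping.keys ` lit_within W = Pow W"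
  proof
    show "Poly_Mapping.keys ` lit_within W \<subseteq> Pow W"
      by (auto simp: lit_within_def in_keys_iff)
    show "Pow W \<subseteq> Poly_Mapping.keys ` lit_within W"
    proof
      fix A assume "A \<in> Pow W"
      then have A: "A \<subseteq> W" "finite A" using assms finite_subset by auto
      define f where "f = Poly_Mapping.Abs_poly_mapping (\<lambda>i. if i \<in> A then 1 else 0 :: bit)"
      have f: "Poly_Mapping.lookup f i = (if i \<in> A then 1 else 0)" for i
        unfolding f_def using A by (subst lookup_Abs_poly_mapping) auto
      have "Poly_Mapping.keys f = A" by (auto simp: in_keys_iff f split: if_splits)
      moreover have "f \<in> lit_within W" using A by (auto simp: lit_within_def f)
      ultimately show "A \<in> Poly_Mapping.keys ` lit_within W" by blast
    qed
  qed
qed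

lemma finite_lit_within: "finite W \<Longrightarrow> finite (lit_within W)"
  using bij_betw_keys_lit_within bij_betw_finite by (metis finite_Pow_iff)

lemma card_lit_within: "finite W \<Longrightarrow> card (lit_within W) = 2 ^ card W"
  using bij_betw_keys_lit_within bij_betw_same_card by (metis card_Pow)

abbreviation bit_sign :: "bit \<Rightarrow> complex" where
  "bit_sign b \<equiv> (if b = 0 then 1 else - 1)"

definition window :: "nat \<Rightarrow> nat \<Rightarrow> int \<Rightarrow> int set" where
  "window l r n = {n - int r..n + int l + 1}"

text \<open>For fixed \<open>n\<close> these are the coefficients of 2^(l+r+2) times the product of
  the projections (1 + lamp i)/2 over the inner window positions and (1 - lamp i)/2 at the two
  ends.\<close>

definition boundary_sign :: "nat \<Rightarrow> nat \<Rightarrow> int \<Rightarrow> (int \<Rightarrow>\<^sub>0 bit) \<Rightarrow> complex" where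
  "boundary_sign l r n f =
     (if f \<in> lit_within (window l r n)
      then bit_sign (Poly_Mapping.lookup f (n - int r)) * bit_sign (Poly_Mapping.lookup f (n + int l + 1))
      else 0)"

lemma boundary_sign_shift: "boundary_sign l r (n + d) (shift d f) = boundary_sign l r n f"
proof -
  have "shift d f \<in> lit_within (window l r (n + d)) \<longleftrightarrow> f \<in> lit_within (window l r n)"
  proof -
    have "(\<forall>i. P (i - d) \<longrightarrow> i \<in> window l r (n + d)) \<longleftrightarrow> (\<forall>i. P i \<longrightarrow> i \<in> window l r n)" for P
    proof -
      have "i - d \<in> window l r n \<longleftrightarrow> i \<in> window l r (n + d)" for i
        by (auto simp: window_def)
      then show ?thesis by (metis add_diff_cancel_right')
    qed
    then show ?thesis by (simp add: lit_within_def lookup_shift)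
  qed
  then show ?thesis
    by (simp add: boundary_sign_def lookup_shift algebra_simps)
qed

text \<open>A lamp acts as -1 on the factor of a closed edge and as 1 on the factor of an open one.
  The offset \<open>d\<close> from the vertex labels the edges of the path.\<close>

lemma boundary_sign_flip:
  assumes "- int r \<le> d" "d \<le> int l + 1"
  shows "boundary_sign l r n (lamp (n + d) + f) =
    (if d = - int r \<or> d = int l + 1 then - boundary_sign l r n f else boundary_sign l r n f)"
proof -
  have "n + d \<in> window l r n" using assms by (simp add: window_def)
  then have "lamp (n + d) + f \<in> lit_within (window l r n) \<longleftrightarrow> f \<in> lit_within (window l r n)"
    by (auto simp: lit_within_def lookup_add lookup_lamp)
  moreover have "bit_sign (1 + b) = - bit_sign b" for b
    by (cases b) auto
  ultimately show ?thesis
    using assms by (auto simp: boundary_sign_def lookup_add lookup_lamp)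
qed

text \<open>Flipping the lamp at \<open>n + d\<close> is an involution that negates
  \<open>P\<close>. Reindexing and negation of \<open>infsum\<close> hold without summability, so
  none is assumed.\<close>

lemma infsum_eq_zero_if_flip:
  fixes P :: "(int \<Rightarrow>\<^sub>0 bit) \<times> int \<Rightarrow> complex"
  assumes "\<And>f n. P (lamp (n + d) + f, n) = - P (f, n)"
  shows "infsum P UNIV = 0"
proof -
  define \<sigma> where "\<sigma> = (\<lambda>(f, n). (lamp (n + d) + f, n))"
  have "bij \<sigma>"
    by (rule bij_betw_byWitness[where f' = \<sigma>]) (auto simp: \<sigma>_def)
  then have "infsum P UNIV = infsum (\<lambda>g. P (\<sigma> g)) UNIV"
    by (metis infsum_reindex_bij_betw)
  also have "\<dots> = infsum (\<lambda>g. - P g) UNIV"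
    by (intro infsum_cong) (auto simp: \<sigma>_def assms)
  also have "\<dots> = - infsum P UNIV" by (rule infsum_uminus)
  finally show ?thesis by simp
qed

definition path_weight :: "nat \<Rightarrow> nat \<Rightarrow> real \<Rightarrow> int \<Rightarrow> complex" where
  "path_weight l r y n =
     (if - int l \<le> n \<and> n \<le> int r then of_real (cheb (nat (n + int l)) y) else 0)"

definition path_vector :: "nat \<Rightarrow> nat \<Rightarrow> real \<Rightarrow> (int \<Rightarrow>\<^sub>0 bit) \<times> int \<Rightarrow> complex" where
  "path_vector l r y = (\<lambda>(f, n). path_weight l r y n * boundary_sign l r n f)"

lemma path_weight_recurrence:
  assumes "- int l \<le> n" "n < int r"
  shows "2 * path_weight l r y (n + 1) + 2 * path_weight l r y (n - 1) = 4 * y * path_weight l r y n"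
proof (cases "nat (n + int l)")
  case 0
  then have "n = - int l" using assms by simp
  \<comment> \<open>At the left end the missing neighbour has weight 0, in accordance with U_(-1) =
    0.\<close>
  then show ?thesis using assms by (simp add: path_weight_def)
next
  case (Suc i)
  then have n: "n = int i + 1 - int l" by linarith
  then show ?thesis using assms
    by (auto simp: path_weight_def nat_add_distrib algebra_simps)
qed

text \<open>With k = l + r + 1, the recurrence 2 U_(k-2) = 4y U_(k-1) - 2 U_k is combined with U_k =
  \<mu> U_(k-1). A one-vertex path has 2y = \<mu>, so both sides are 0.\<close>

lemma path_weight_end:
  fixes y \<mu> :: real
  assumes "cheb (Suc (l + r)) y = \<mu> * cheb (l + r) y"
  shows "2 * path_weight l r y (int r - 1) = (4 * y - 2 * \<mu>) * path_weight l r y (int r)"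
proof (cases "l + r")
  case 0
  then show ?thesis using arg_cong[OF assms, of complex_of_real] by (simp add: path_weight_def)
next
  case (Suc i)
  then have n: "nat (int r + int l) = Suc i" "nat (int r - 1 + int l) = i" by linarith+
  have "2 * cheb i y = (4 * y - 2 * \<mu>) * cheb (Suc i) y"
    using assms unfolding Suc by (simp add: algebra_simps)
  then have "complex_of_real (2 * cheb i y) = of_real ((4 * y - 2 * \<mu>) * cheb (Suc i) y)"
    by (rule arg_cong)
  then show ?thesis using Suc unfolding path_weight_def n by simp
qed

text \<open>A hop along an open edge has weight 2 and along a closed edge 0. The diagonal entry is
  -\<mu>, except at the right end, where lamp 0 belongs to a closed edge and the entry is
  \<mu>.\<close>

lemma path_vector_eigenvector:
  assumes y: "y = (s + \<mu>) / 4" and root: "cheb (Suc (l + r)) y = \<mu> * cheb (l + r) y"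
  shows "lamplighter_operator \<mu> (path_vector l r y) = (\<lambda>g. of_real s * path_vector l r y g)"
proof (rule ext, clarify)
  fix f :: "int \<Rightarrow>\<^sub>0 bit" and n :: int
  define \<psi> where "\<psi> = path_weight l r y"
  define \<epsilon> where "\<epsilon> = boundary_sign l r n"
  have out: "\<psi> m = 0" if "m < - int l \<or> m > int r" for m
    using that by (auto simp: \<psi>_def path_weight_def)
  have sy: "4 * complex_of_real y = of_real s + of_real \<mu>"
    using arg_cong[of "4 * y" "s + \<mu>" complex_of_real] by (simp add: y)
  \<comment> \<open>A hop moves vertex and lamps by the same amount, so all signs can be read off at
    vertex \<open>n\<close>.\<close>
  have sh: "boundary_sign l r (n - 1) (shift (- 1) f) = \<epsilon> f"
    "boundary_sign l r (n + 1) (shift 1 f) = \<epsilon> f"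
    "boundary_sign l r (n - 1) (lamp 0 + shift (- 1) f) = \<epsilon> (lamp 1 + f)"
    "boundary_sign l r (n + 1) (shift 1 (lamp 0 + f)) = \<epsilon> (lamp 0 + f)"
    unfolding \<epsilon>_def
    using boundary_sign_shift[of l r n "- 1" f] boundary_sign_shift[of l r n 1 f]
      boundary_sign_shift[of l r n "- 1" "lamp 1 + f"] boundary_sign_shift[of l r n 1 "lamp 0 + f"]
    by simp_all
  have op: "lamplighter_operator \<mu> (path_vector l r y) (f, n) = \<psi> (n - 1) * (\<epsilon> f + \<epsilon> (lamp 1 + f))
      + \<psi> (n + 1) * (\<epsilon> f + \<epsilon> (lamp 0 + f)) - \<mu> * \<psi> n * \<epsilon> (lamp 0 + f)"
    unfolding lamplighter_operator_apply path_vector_def prod.case sh \<psi>_def[symmetric] \<epsilon>_def[symmetric]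
    by (simp add: algebra_simps)
  \<comment> \<open>Lamp 1 has offset 1 - n from vertex \<open>n\<close>. At n = r + 1 this is the
    end -r of the window, and the two terms cancel: nothing leaves the path on the right. The next
    claim treats the left end in the same way.\<close>
  have "\<psi> (n - 1) * (\<epsilon> f + \<epsilon> (lamp 1 + f)) = (if n \<le> int r then 2 * \<psi> (n - 1) * \<epsilon> f else 0)"
    using boundary_sign_flip[of r "1 - n" l n f] out[of "n - 1"]
    by (cases "n - 1 < - int l \<or> n - 1 > int r") (auto simp: \<epsilon>_def)
  moreover have "\<psi> (n + 1) * (\<epsilon> f + \<epsilon> (lamp 0 + f)) = (if - int l \<le> n then 2 * \<psi> (n + 1) * \<epsilon> f else 0)"
    using boundary_sign_flip[of r "- n" l n f] out[of "n + 1"]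
    by (cases "n + 1 < - int l \<or> n + 1 > int r") (auto simp: \<epsilon>_def)
  \<comment> \<open>Lamp 0 has offset -n, which for a vertex of the path is an end of the window
    only when n = r.\<close>
  moreover have "\<mu> * \<psi> n * \<epsilon> (lamp 0 + f) = (if n = int r then - \<mu> * \<psi> n * \<epsilon> f else \<mu> * \<psi> n * \<epsilon> f)"
    using boundary_sign_flip[of r "- n" l n f] out[of "n"]
    by (cases "n < - int l \<or> n > int r") (auto simp: \<epsilon>_def)
  ultimately have "lamplighter_operator \<mu> (path_vector l r y) (f, n) =
      (if n \<le> int r then 2 * \<psi> (n - 1) * \<epsilon> f else 0) + (if - int l \<le> n then 2 * \<psi> (n + 1) * \<epsilon> f else 0)
      - (if n = int r then - \<mu> * \<psi> n * \<epsilon> f else \<mu> * \<psi> n * \<epsilon> f)"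
    unfolding op by (simp only:)
  also have "\<dots> = of_real s * \<psi> n * \<epsilon> f"
  proof -
    consider "n < - int l" | "- int l \<le> n" "n < int r" | "n = int r" | "n > int r" by linarith
    then show ?thesis
    proof cases
      case 1
      then show ?thesis using out[of n] out[of "n - 1"] by simp
    next
      case 2
      then have "2 * \<psi> (n + 1) + 2 * \<psi> (n - 1) = (s + \<mu>) * \<psi> n"
        using path_weight_recurrence[of l n r y] by (simp add: sy \<psi>_def)
      then have "(2 * \<psi> (n + 1) + 2 * \<psi> (n - 1)) * \<epsilon> f = (s + \<mu>) * \<psi> n * \<epsilon> f" by simp
      then show ?thesis using 2 by (simp add: algebra_simps)
    next
      case 3
      then have "2 * \<psi> (n - 1) = (s - \<mu>) * \<psi> n"
        using path_weight_end[OF root] by (simp add: sy \<psi>_def)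
      then have "2 * \<psi> (n - 1) * \<epsilon> f = (s - \<mu>) * \<psi> n * \<epsilon> f" by simp
      then show ?thesis using 3 out[of "n + 1"] by (simp add: algebra_simps)
    next
      case 4
      then show ?thesis using out[of n] out[of "n + 1"] by simp
    qed
  qed
  finally show "lamplighter_operator \<mu> (path_vector l r y) (f, n) = of_real s * path_vector l r y (f, n)"
    by (simp add: path_vector_def \<psi>_def \<epsilon>_def)
qed

text \<open>Some edge is closed for one path and open for the other; flipping its lamp negates the
  product of the two vectors.\<close>

lemma path_vector_orthogonal:
  assumes "(l, r) \<noteq> (l', r')"
  shows "ell2_inner (path_vector l r y) (path_vector l' r' y') = 0"
proof -
  have cnj: "cnj (boundary_sign l r n f) = boundary_sign l r n f" for l r n f
    by (simp add: boundary_sign_def)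
  \<comment> \<open>On a side where the two paths differ, the end of the shorter window lies
    strictly inside the other one.\<close>
  have "\<exists>d. (- int r \<le> d \<and> d \<le> int l + 1) \<and> (- int r' \<le> d \<and> d \<le> int l' + 1) \<and>
     ((d = - int r \<or> d = int l + 1) \<noteq> (d = - int r' \<or> d = int l' + 1))"
  proof -
    consider "l < l'" | "l' < l" | "r < r'" | "r' < r" using assms by fastforce
    then show ?thesis
    proof cases
      case 1 then show ?thesis by (intro exI[of _ "int l + 1"]) auto
    next
      case 2 then show ?thesis by (intro exI[of _ "int l' + 1"]) auto
    next
      case 3 then show ?thesis by (intro exI[of _ "- int r"]) auto
    next
      case 4 then show ?thesis by (intro exI[of _ "- int r'"]) auto
    qed
  qed
  then obtain d where d: "- int r \<le> d" "d \<le> int l + 1" "- int r' \<le> d" "d \<le> int l' + 1"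
     "(d = - int r \<or> d = int l + 1) \<noteq> (d = - int r' \<or> d = int l' + 1)" by blast
  show ?thesis
    unfolding ell2_inner_def
    by (rule infsum_eq_zero_if_flip[of _ d]) (use d in \<open>auto simp: path_vector_def boundary_sign_flip cnj\<close>)
qed

text \<open>The pairs are swapped because the range of lamp configurations depends on the vertex,
  the second component.\<close>

definition path_support :: "nat \<Rightarrow> nat \<Rightarrow> ((int \<Rightarrow>\<^sub>0 bit) \<times> int) set" where
  "path_support l r = prod.swap ` (SIGMA n:{- int l..int r}. lit_within (window l r n))"

lemma finite_path_support: "finite (path_support l r)"
  unfolding path_support_def by (auto simp: window_def intro!: finite_imageI finite_SigmaI finite_lit_within)

lemma path_vector_outside: "g \<notin> path_support l r \<Longrightarrow> path_vector l r y g = 0"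
  by (cases g) (force simp: path_support_def path_vector_def path_weight_def boundary_sign_def)

lemma path_vector_ell2: "path_vector l r y \<in> ell2"
  by (rule ell2_finite_support, rule finite_subset[OF _ finite_path_support[of l r]])
    (use path_vector_outside in blast)

text \<open>On the support the signs square to 1, and each vertex carries 2^(l+r+2) configurations;
  what remains is the Christoffel-Darboux kernel.\<close>

lemma path_vector_inner:
  "ell2_inner (path_vector l r y) (path_vector l r y') =
     of_real (2 ^ (l + r + 2) * (\<Sum>i\<le>l + r. cheb i y * cheb i y'))"
proof -
  have "ell2_inner (path_vector l r y) (path_vector l r y') =
      (\<Sum>\<^sub>\<infinity>g\<in>path_support l r. path_vector l r y g * cnj (path_vector l r y' g))"
    unfolding ell2_inner_def by (rule infsum_cong_neutral) (auto simp: path_vector_outside)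
  also have "\<dots> = (\<Sum>g\<in>path_support l r. path_vector l r y g * cnj (path_vector l r y' g))"
    by (simp add: finite_path_support)
  also have "\<dots> = (\<Sum>(n, f)\<in>(SIGMA n:{- int l..int r}. lit_within (window l r n)).
      path_vector l r y (f, n) * cnj (path_vector l r y' (f, n)))"
    unfolding path_support_def by (subst sum.reindex) (auto intro!: sum.cong simp: inj_on_def)
  also have "\<dots> = (\<Sum>n\<in>{- int l..int r}. \<Sum>f\<in>lit_within (window l r n).
      path_vector l r y (f, n) * cnj (path_vector l r y' (f, n)))"
    by (subst sum.Sigma) (auto intro!: finite_lit_within simp: window_def)
  also have "\<dots> = (\<Sum>n\<in>{- int l..int r}. of_real (2 ^ (l + r + 2) * (cheb (nat (n + int l)) y * cheb (nat (n + int l)) y')))"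
  proof (intro sum.cong refl)
    fix n assume n: "n \<in> {- int l..int r}"
    have "card (window l r n) = l + r + 2"
      by (simp add: window_def nat_add_distrib algebra_simps)
    then have "card (lit_within (window l r n)) = 2 ^ (l + r + 2)"
      by (subst card_lit_within) (simp_all add: window_def)
    moreover have "path_vector l r y (f, n) * cnj (path_vector l r y' (f, n)) =
        of_real (cheb (nat (n + int l)) y * cheb (nat (n + int l)) y')"
      if "f \<in> lit_within (window l r n)" for f
      using that n by (auto simp: path_vector_def path_weight_def boundary_sign_def)
    ultimately show "(\<Sum>f\<in>lit_within (window l r n). path_vector l r y (f, n) * cnj (path_vector l r y' (f, n))) =
        of_real (2 ^ (l + r + 2) * (cheb (nat (n + int l)) y * cheb (nat (n + int l)) y'))"
      by simp
  qed
  also have "\<dots> = (\<Sum>i\<le>l + r. of_real (2 ^ (l + r + 2) * (cheb i y * cheb i y')))"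
    by (rule sum.reindex_bij_witness[of _ "\<lambda>i. int i - int l" "\<lambda>n. nat (n + int l)"]) auto
  finally show ?thesis
    by (simp add: sum_distrib_left)
qed

text \<open>The identity sits at vertex 0, which has \<open>l\<close> vertices to its left, with all
  lamps off.\<close>

lemma path_vector_delta:
  "ell2_inner (ell2_delta \<one>\<^bsub>lamplighter\<^esub>) (path_vector l r y) = of_real (cheb l y)"
proof -
  have "ell2_inner (ell2_delta \<one>\<^bsub>lamplighter\<^esub>) (path_vector l r y) =
      (\<Sum>\<^sub>\<infinity>g\<in>{(0, 0)}. ell2_delta \<one>\<^bsub>lamplighter\<^esub> g * cnj (path_vector l r y g))"
    unfolding ell2_inner_def by (rule infsum_cong_neutral) (auto simp: ell2_delta_def lamplighter_one)
  then show ?thesis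
    by (simp add: ell2_delta_def lamplighter_one path_vector_def path_weight_def boundary_sign_def lit_within_def)
qed

section \<open>The spectral measure\<close>

lemma emeasure_G_poly_roots:
  assumes "B \<in> sets borel"
  shows "(\<Sum>s | poly (G_poly (Suc n) \<mu>) s = 0.
      of_nat (Polynomial.order s (G_poly (Suc n) \<mu>)) * emeasure (return borel s) B) =
    ennreal (card ({s. poly (G_poly (Suc n) \<mu>) s = 0} \<inter> B))"
proof -
  let ?R = "{s. poly (G_poly (Suc n) \<mu>) s = 0}"
  have fin: "finite ?R" by (intro poly_roots_finite G_poly_nonzero)
  have "(\<Sum>s\<in>?R. of_nat (Polynomial.order s (G_poly (Suc n) \<mu>)) * emeasure (return borel s) B) =
      (\<Sum>s\<in>?R. ennreal (indicator B s))"
    using assms rsquarefree_root_order[OF rsquarefree_G_poly _ G_poly_nonzero]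
    by (intro sum.cong) (auto simp: indicator_def)
  also have "\<dots> = ennreal (\<Sum>s\<in>?R. indicator B s)"
    by (rule sum_ennreal) auto
  also have "(\<Sum>s\<in>?R. indicator B s) = real (card (?R \<inter> B))"
    using fin by (simp add: indicator_def of_bool_def sum.If_cases)
  finally show ?thesis .
qed

lemma sum_suc_over_power: "(\<Sum>n<N. real (Suc n) / 2 ^ (n + 2)) = 1 - (real N + 2) / 2 ^ (N + 1)"
  by (induction N) (auto simp: field_simps)

text \<open>The total mass of the claimed measure: k = n + 1 zeros, each with weight
  1/2^(k+1).\<close>

lemma sums_suc_over_power: "(\<lambda>n. real (Suc n) / 2 ^ (n + 2)) sums 1"
proof -
  have "(\<lambda>N. 1 - (real N + 2) / 2 ^ (N + 1)) \<longlonglongrightarrow> 1"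
    by real_asymp
  then show ?thesis
    unfolding sums_def sum_suc_over_power .
qed

lemma lamplighter_spectral_measure_ge:
  assumes res: "spectral_resolution (lamplighter_operator \<mu>) E" and B: "B \<in> sets borel"
  shows "(\<Sum>n<N. real (card ({s. poly (G_poly (Suc n) \<mu>) s = 0} \<inter> B)) / 2 ^ (n + 2)) \<le>
    Re (ell2_inner (E B (ell2_delta \<one>\<^bsub>lamplighter\<^esub>)) (ell2_delta \<one>\<^bsub>lamplighter\<^esub>))"
proof -
  define R where "R n = {s. poly (G_poly (Suc n) \<mu>) s = 0}" for n
  define y where "y s = (s + \<mu>) / 4" for s
  \<comment> \<open>The squared norm of the Jacobi eigenvector, without the factor for the lamp
    configurations.\<close>
  define Q where "Q n s = (\<Sum>i\<le>n. cheb i (y s) * cheb i (y s))" for n s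
  define I where "I = (SIGMA n:{..<N}. {..n} \<times> R n)"
  \<comment> \<open>The path has \<open>n + 1\<close> vertices, with \<open>l\<close> of them to the
    left of the origin and \<open>n - l\<close> to the right.\<close>
  define w where "w = (\<lambda>(n, l, s). path_vector l (n - l) (y s))"
  define e where "e = (\<lambda>(n :: nat, l :: nat, s :: real). s)"
  let ?d = "ell2_delta \<one>\<^bsub>lamplighter\<^esub>"
  have finR: "finite (R n)" for n
    unfolding R_def by (intro poly_roots_finite G_poly_nonzero)
  have root: "cheb (Suc n) (y s) = \<mu> * cheb n (y s)" if "s \<in> R n" for n s
  proof -
    have "cheb (Suc n) (- y s) + \<mu> * cheb n (- y s) = 0"
      using that by (simp add: R_def poly_G_poly_Suc y_def minus_divide_left)
    then have "(- 1) ^ n * (cheb (Suc n) (y s) - \<mu> * cheb n (y s)) = 0"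
      unfolding cheb_minus by (simp add: algebra_simps)
    then show ?thesis by simp
  qed
  have Qpos: "Q n s > 0" for n s
  proof -
    have "0 < cheb 0 (y s) * cheb 0 (y s)" by simp
    also have "\<dots> \<le> Q n s" unfolding Q_def by (rule member_le_sum) auto
    finally show ?thesis .
  qed
  \<comment> \<open>Both zeros satisfy U_(n+1) = \<mu> U_n with the same \<mu>, so the right side of
    Christoffel-Darboux cancels.\<close>
  have orth: "(\<Sum>i\<le>n. cheb i (y s) * cheb i (y s')) = 0" if "s \<in> R n" "s' \<in> R n" "s \<noteq> s'" for n s s'
  proof -
    have "2 * (y s - y s') * (\<Sum>i\<le>n. cheb i (y s) * cheb i (y s')) = 0"
      unfolding christoffel_darboux root[OF that(1)] root[OF that(2)] by simp
    then show ?thesis using that by (simp add: y_def)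
  qed
  have norm: "ell2_inner (w (n, l, s)) (w (n, l, s)) = of_real (2 ^ (n + 2) * Q n s)" if "l \<le> n" for n l s
    using that by (simp add: w_def path_vector_inner Q_def)
  have "(\<Sum>i\<in>I. (cmod (ell2_inner ?d (w i)))\<^sup>2 / Re (ell2_inner (w i) (w i)) * indicator B (e i))
      \<le> Re (ell2_inner (E B ?d) ?d)"
  proof (rule spectral_measure_ge_eigenvectors[OF res lamplighter_operator_ell2 lamplighter_operator_linear _ _ _ _ _ _ B])
    show "finite I" unfolding I_def by (auto intro!: finite_SigmaI finR)
    show "?d \<in> ell2" by (rule ell2_delta_ell2)
    show "w i \<in> ell2" for i by (cases i) (simp add: w_def path_vector_ell2)
    show "lamplighter_operator \<mu> (w i) = (\<lambda>g. of_real (e i) * w i g)" if "i \<in> I" for i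
      using that root by (auto simp: I_def w_def e_def y_def intro!: path_vector_eigenvector)
    show "Re (ell2_inner (w i) (w i)) > 0" if "i \<in> I" for i
      using that by (auto simp: I_def norm Qpos)
    show "ell2_inner (w i) (w j) = 0" if "i \<in> I" "j \<in> I" "i \<noteq> j" for i j
    proof -
      obtain n l s n' l' s' where ij: "i = (n, l, s)" "j = (n', l', s')" by (metis surj_pair)
      have le: "l \<le> n" "l' \<le> n'" "s \<in> R n" "s' \<in> R n'" using that by (auto simp: I_def ij)
      show ?thesis
      proof (cases "(n, l) = (n', l')")
        case True
        then show ?thesis
          using le that orth[of s n s'] by (simp add: w_def ij path_vector_inner)
      next
        case False
        then have "(l, n - l) \<noteq> (l', n' - l')" using le by auto
        then show ?thesis by (simp add: w_def ij path_vector_orthogonal)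
      qed
    qed
  qed
  also have "(\<Sum>i\<in>I. (cmod (ell2_inner ?d (w i)))\<^sup>2 / Re (ell2_inner (w i) (w i)) * indicator B (e i)) =
      (\<Sum>n<N. \<Sum>(l, s)\<in>{..n} \<times> R n. (cheb l (y s))\<^sup>2 / (2 ^ (n + 2) * Q n s) * indicator B s)"
    unfolding I_def
    by (subst sum.Sigma) (auto intro!: sum.cong finR simp: norm e_def, auto simp: w_def path_vector_delta)
  also have "\<dots> = (\<Sum>n<N. real (card (R n \<inter> B)) / 2 ^ (n + 2))"
  proof (intro sum.cong refl)
    fix n
    have "(\<Sum>(l, s)\<in>{..n} \<times> R n. (cheb l (y s))\<^sup>2 / (2 ^ (n + 2) * Q n s) * indicator B s) =
        (\<Sum>s\<in>R n. \<Sum>l\<le>n. (cheb l (y s))\<^sup>2 / (2 ^ (n + 2) * Q n s) * indicator B s)"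
      by (subst sum.swap) (rule sum.cartesian_product[symmetric])
    also have "\<dots> = (\<Sum>s\<in>R n. indicator B s / 2 ^ (n + 2))"
    proof (intro sum.cong refl)
      fix s
      \<comment> \<open>Over all positions \<open>l\<close> of the origin the squared entries add up
        to \<open>Q n s\<close>, which cancels the normalisation.\<close>
      have "(\<Sum>l\<le>n. (cheb l (y s))\<^sup>2 / (2 ^ (n + 2) * Q n s) * indicator B s) =
          Q n s * (indicator B s / (2 ^ (n + 2) * Q n s))"
        unfolding Q_def by (subst sum_distrib_right) (simp add: power2_eq_square)
      also have "\<dots> = indicator B s / 2 ^ (n + 2)"
        using Qpos[of n s] by simp
      finally show "(\<Sum>l\<le>n. (cheb l (y s))\<^sup>2 / (2 ^ (n + 2) * Q n s) * indicator B s) =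
          indicator B s / 2 ^ (n + 2)" .
    qed
    also have "\<dots> = real (card (R n \<inter> B)) / 2 ^ (n + 2)"
      using finR[of n] by (simp add: sum_divide_distrib[symmetric] indicator_def of_bool_def sum.If_cases)
    finally show "(\<Sum>(l, s)\<in>{..n} \<times> R n. (cheb l (y s))\<^sup>2 / (2 ^ (n + 2) * Q n s) * indicator B s) =
        real (card (R n \<inter> B)) / 2 ^ (n + 2)" .
  qed
  finally show ?thesis by (simp add: R_def)
qed

text \<open>The lower bounds for \<open>B\<close> and for its complement add up to the total mass, so both are sharp.\<close>

lemma lamplighter_spectral_measure_sums:
  assumes res: "spectral_resolution (lamplighter_operator \<mu>) E" and B: "B \<in> sets borel"
  shows "(\<lambda>n. real (card ({s. poly (G_poly (Suc n) \<mu>) s = 0} \<inter> B)) / 2 ^ (n + 2)) sums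
    Re (ell2_inner (E B (ell2_delta \<one>\<^bsub>lamplighter\<^esub>)) (ell2_delta \<one>\<^bsub>lamplighter\<^esub>))"
proof -
  let ?d = "ell2_delta \<one>\<^bsub>lamplighter\<^esub>"
  have pvm: "projection_valued_measure E"
    using res unfolding spectral_resolution_def by blast
  define R where "R n = {s. poly (G_poly (Suc n) \<mu>) s = 0}" for n
  define \<nu> where "\<nu> B = Re (ell2_inner (E B ?d) ?d)" for B
  define S where "S B N = (\<Sum>n<N. real (card (R n \<inter> B)) / 2 ^ (n + 2))" for B N
  have d: "?d \<in> ell2" by (rule ell2_delta_ell2)
  have "ell2_inner ?d ?d = (\<Sum>\<^sub>\<infinity>g\<in>{\<one>\<^bsub>lamplighter\<^esub>}. 1)"
    unfolding ell2_inner_def by (rule infsum_cong_neutral) (auto simp: ell2_delta_def)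
  then have one: "ell2_inner ?d ?d = 1" by simp
  have "E (- B) ?d \<in> ell2" "E B ?d \<in> ell2"
    using B d by (auto intro: pvm_ell2[OF pvm])
  then have compl: "\<nu> (- B) = 1 - \<nu> B"
    using d B one by (simp add: \<nu>_def pvm_compl[OF pvm] ell2_inner_diff_left)
  have ge: "S B N \<le> \<nu> B" "S (- B) N \<le> \<nu> (- B)" for N
    using lamplighter_spectral_measure_ge[OF res] B by (auto simp: S_def \<nu>_def R_def)
  \<comment> \<open>Each of the n + 1 distinct zeros lies in exactly one of \<open>B\<close> and its
    complement.\<close>
  have tot: "S B N + S (- B) N = (\<Sum>n<N. real (Suc n) / 2 ^ (n + 2))" for N
    unfolding S_def sum.distrib[symmetric]
  proof (intro sum.cong refl)
    fix n
    have "finite (R n)" unfolding R_def by (intro poly_roots_finite G_poly_nonzero)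
    then have "card (R n) = card (R n \<inter> B) + card (R n \<inter> - B)"
      by (subst card_Un_disjoint[symmetric]) (auto intro: arg_cong[of _ _ card])
    then show "real (card (R n \<inter> B)) / 2 ^ (n + 2) + real (card (R n \<inter> - B)) / 2 ^ (n + 2) =
        real (Suc n) / 2 ^ (n + 2)"
      by (simp add: R_def card_roots_G_poly add_divide_distrib[symmetric] flip: of_nat_add)
  qed
  have bound: "\<nu> B - S B N \<le> 1 - (\<Sum>n<N. real (Suc n) / 2 ^ (n + 2))" for N
    using ge(2)[of N] compl tot[of N] by linarith
  \<comment> \<open>The gap is squeezed between 0 and the tail of a series with sum 1.\<close>
  have "(\<lambda>N. \<nu> B - S B N) \<longlonglongrightarrow> 0"
  proof (rule tendsto_sandwich[OF always_eventually always_eventually])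
    show "\<forall>N. 0 \<le> \<nu> B - S B N" using ge(1) by simp
    show "\<forall>N. \<nu> B - S B N \<le> 1 - (\<Sum>n<N. real (Suc n) / 2 ^ (n + 2))" using bound by blast
    show "(\<lambda>N. 1 - (\<Sum>n<N. real (Suc n) / 2 ^ (n + 2))) \<longlonglongrightarrow> 0"
      using tendsto_diff[OF tendsto_const[of 1] sums_suc_over_power[unfolded sums_def]] by simp
  qed auto
  then have "(\<lambda>N. \<nu> B - (\<nu> B - S B N)) \<longlonglongrightarrow> \<nu> B - 0"
    by (intro tendsto_diff tendsto_const)
  then show ?thesis
    by (simp add: sums_def S_def \<nu>_def R_def)
qed

text \<open>Every family of extended nonnegative reals is summable, so the unordered and the ordered
  sum agree.\<close>

lemma infsum_ennreal_eq_suminf: "infsum f UNIV = suminf (f :: nat \<Rightarrow> ennreal)"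
proof -
  have "(f has_sum infsum f UNIV) UNIV"
    by (rule has_sum_infsum) (rule nonneg_summable_on_complete, simp)
  then show ?thesis
    by (rule sums_unique[OF has_sum_imp_sums])
qed

theorem theorem2:
  fixes \<mu> :: real
    and E :: "real set \<Rightarrow> ((int \<Rightarrow>\<^sub>0 bit) \<times> int \<Rightarrow> complex) \<Rightarrow> ((int \<Rightarrow>\<^sub>0 bit) \<times> int \<Rightarrow> complex)"
    and B :: "real set"
  assumes "spectral_resolution (lamplighter_operator \<mu>) E"
    and "B \<in> sets borel"
  shows "emeasure (spectral_measure_at E (ell2_delta \<one>\<^bsub>lamplighter\<^esub>)) B =
           ennreal (1 / 4) * emeasure (return borel \<mu>) B +
           (\<Sum>\<^sub>\<infinity>k\<in>{2..}. ennreal (1 / 2 ^ (k + 1)) *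
              (\<Sum>s | poly (G_poly k \<mu>) s = 0.
                 of_nat (Polynomial.order s (G_poly k \<mu>)) * emeasure (return borel s) B))"
proof -
  let ?d = "ell2_delta \<one>\<^bsub>lamplighter\<^esub>"
  define \<nu> where "\<nu> = Re (ell2_inner (E B ?d) ?d)"
  \<comment> \<open>Here \<open>n\<close> stands for k = n + 1, so the denominator is
    2^(k+1).\<close>
  define \<rho> where "\<rho> n = real (card ({s. poly (G_poly (Suc n) \<mu>) s = 0} \<inter> B)) / 2 ^ (n + 2)" for n
  define F where "F k = ennreal (1 / 2 ^ (k + 1)) *
      (\<Sum>s | poly (G_poly k \<mu>) s = 0.
        of_nat (Polynomial.order s (G_poly k \<mu>)) * emeasure (return borel s) B)" for k
  have pvm: "projection_valued_measure E"
    using assms unfolding spectral_resolution_def by blast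
  have d: "?d \<in> ell2" by (rule ell2_delta_ell2)
  have F: "F (Suc n) = ennreal (\<rho> n)" for n
    unfolding F_def \<rho>_def emeasure_G_poly_roots[OF assms(2)]
    by (subst ennreal_mult[symmetric]) auto
  have "\<rho> sums \<nu>"
    unfolding \<rho>_def[abs_def] \<nu>_def by (rule lamplighter_spectral_measure_sums[OF assms])
  moreover have "\<nu> \<ge> 0"
    unfolding \<nu>_def by (rule pvm_nonneg[OF pvm assms(2) d])
  ultimately have "(\<lambda>n. ennreal (\<rho> n)) sums ennreal \<nu>"
    by (subst sums_ennreal) (auto simp: \<rho>_def)
  then have "ennreal \<nu> = suminf (\<lambda>n. F (Suc n))"
    by (simp add: F sums_unique)
  also have "\<dots> = F 1 + suminf (\<lambda>n. F (Suc (Suc n)))"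
    using suminf_offset[of "\<lambda>n. F (Suc n)" 1] by simp
  also have "suminf (\<lambda>n. F (Suc (Suc n))) = infsum (\<lambda>n. F (Suc (Suc n))) UNIV"
    by (rule infsum_ennreal_eq_suminf[symmetric])
  also have "\<dots> = infsum F {2..}"
    by (rule infsum_reindex_bij_betw[of "\<lambda>n. Suc (Suc n)" UNIV "{2..}" F], rule bij_betw_byWitness[where f' = "\<lambda>n. n - 2"]) auto
  also have "F 1 = ennreal (1 / 4) * emeasure (return borel \<mu>) B"
  proof -
    \<comment> \<open>The one-vertex paths account for the separate atom: G_1(z) = \<mu> - z, with
      weight 1/2^2.\<close>
    have "{s. poly (G_poly (Suc 0) \<mu>) s = 0} = {\<mu>}"
      unfolding poly_G_poly_Suc by (auto simp: field_simps)
    then have "F 1 = ennreal (real (card ({\<mu>} \<inter> B)) / 4)"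
      using F[of 0] by (simp add: \<rho>_def)
    then show ?thesis
      using assms(2) by (auto simp: indicator_def)
  qed
  finally show ?thesis
    unfolding \<nu>_def F_def using emeasure_spectral_measure_at[OF pvm d assms(2)] by simp
qed

end
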